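(* Let $K$ be a field, let $q\in K$ with $q\ne0,1$ have quantum characteristic $e$, and suppose that $1\le s\le e$, $(\Lambda,\alpha_s)>0$ and $\varepsilon\in\{+,-\}$. Then, in $\mathscr H^\Lambda_n$, $$z^{\varepsilon,s}_n=C\,e(\mathbf i^{\varepsilon,s}_n)\,y^{\varepsilon,s}_n$$ for some non-zero constant $C\in K$. In particular, $\deg z^{\varepsilon,s}_n=2(d^{\varepsilon,s}_1+\dots+d^{\varepsilon,s}_n)$.
   Context: **Hecke algebra.** The quantum characteristic of $q$ is the least positive $e$ with $1+q+\dots+q^{e-1}=0$, or $0$ if none (the hypothesis $1\le s\le e$ forces $e\ge2$). $I=\mathbb Z/e\mathbb Z$; $s$ is also regarded as an element of $I$. $a_{i,j}=2$ if $i=j$; $-1$ if $e\ne2$, $i=j\pm1$; $-2$ if $e=2$, $i\ne j$; $0$ otherwise. $\Lambda_i,\alpha_i$ ($i\in I$) are fundamental weights and simple roots with $(\Lambda_i,\alpha_j)=\delta_{ij}$. Fix $\Lambda\in\bigoplus_i\mathbb N_0\Lambda_i$ and $n\ge1$. $\mathscr H^\Lambda_n$ is the $K$-algebra with generators $L_1,\dots,L_n,T_1,\dots,T_{n-1}$ and relations $\prod_{i\in I}(L_1-q^i)^{(\Lambda,\alpha_i)}=0$, $L_rL_t=L_tL_r$, $(T_r+1)(T_r-q)=0$, $T_rL_r=L_{r+1}(T_r-q+1)$, $T_rT_{r+1}T_r=T_{r+1}T_rT_{r+1}$, $T_rL_t=L_tT_r$ if $t\ne r,r+1$, $T_rT_t=T_tT_r$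 if $|r-t|>1$. For $w\in\mathfrak S_n$ with length $\ell(w)$, $T_w$ is the product of $T_i$ along a reduced expression. $\mathscr H^\Lambda_n=\bigoplus_{\mathbf i\in I^n}\mathscr H_{\mathbf i}$, $\mathscr H_{\mathbf i}=\{h\mid h(L_r-q^{i_r})^N=0\ \forall r,\ N\gg0\}$; $e(\mathbf i)$ is the idempotent such that right multiplication by it is the projection onto $\mathscr H_{\mathbf i}$; $y_r=\sum_{\mathbf i}(1-q^{-i_r}L_r)e(\mathbf i)$. **Grading.** $\mathscr H^\Lambda_n$ carries the $\mathbb Z$-grading transported from the cyclotomic Khovanov--Lauda--Rouquier algebra by the Brundan--Kleshchev isomorphism: it is generated by the idempotents $e(\mathbf i)$ (right multiplication by $e(\mathbf i)$ being the projection of $\mathscr H^\Lambda_n$ onto $\mathscr H_{\mathbf i}$), the elements $y_r=\sum_{\mathbf i}(1-q^{-i_r}L_r)e(\mathbf i)$ and by elements $\psi_r=\sum_{\mathbf i}(T_r+P_r(\mathbf i))Q_r(\mathbf i)^{-1}e(\mathbf i)$ for certain power series $P_r(\mathbf i),Q_r(\mathbf i)\in K[[y_r,y_{r+1}]]$ ($Q_r(\mathbf i)$ invertible), which satisfy the Khovanov--Lauda--Rouquier relations, and is graded by $\deg e(\mathbf i)=0$, $\deg y_r=2$, $\deg\psi_re(\mathbf i)=-a_{i_r,i_{r+1}}$. **Elements.** $u_{n,s}=\prod_{i\in I}\big((L_1-q^i)\cdots(L_n-q^i)\big)^{(\Lambda,\alpha_i)-\delta_{is}}$, $x_{(n)}=\sum_{w\in\mathfrak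 S_n}T_w$, $x'_{(n)}=\sum_{w\in\mathfrak S_n}(-q)^{-\ell(w)}T_w$; $z^{+,s}_n=u_{n,s}x_{(n)}$ and $z^{-,s}_n=u_{n,s}x'_{(n)}$. $\mathbf i^{\varepsilon,s}_n=(i^{\varepsilon,s}_1,\dots,i^{\varepsilon,s}_n)\in I^n$ with $i^{\varepsilon,s}_k=s+\varepsilon(k-1)\bmod e$. For $1\le k\le n$, $d^{\varepsilon,s}_k=(\Lambda,\alpha_{i})-\delta_{i,s}+\delta_{e\mid k}$ with $i=i^{\varepsilon,s}_k$, where $\delta_{e\mid k}=1$ if $e$ divides $k$ and $0$ otherwise. $y^{\varepsilon,s}_n=\prod_{k=1}^ny_k^{d^{\varepsilon,s}_k}$. *)

theory Defs
  imports
    Complex_Main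
    "HOL-Library.FuncSet"
    "HOL-Library.Poly_Mapping"
    "HOL-Combinatorics.Permutations"
begin

datatype 'g word = Word "'g list"

instantiation word :: (type) monoid_add
begin

definition zero_word :: "'a word" where "0 = Word []"

fun plus_word :: "'a word \<Rightarrow> 'a word \<Rightarrow> 'a word" where
  "Word xs + Word ys = Word (xs @ ys)"

instance
proof
  fix a b c :: "'a word"
  show "a + b + c = a + (b + c)" by (cases a; cases b; cases c) simp
  show "0 + a = a" by (cases a) (simp add: zero_word_def)
  show "a + 0 = a" by (cases a) (simp add: zero_word_def)
qed

end

text \<open>
  The monoid algebra of the free monoid of words, with the convolution product of
  \<^type>\<open>poly_mapping\<close>, is the free associative unital algebra on the letters.
\<close>

type_synonym ('g, 'k) free_algebra = "'g word \<Rightarrow>\<^sub>0 'k"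

definition free_var :: "'g \<Rightarrow> ('g, 'k::field) free_algebra" where
  "free_var g = Poly_Mapping.single (Word [g]) 1"

definition free_const :: "'k::field \<Rightarrow> ('g, 'k) free_algebra" where
  "free_const c = Poly_Mapping.single 0 c"

definition two_sided_ideal :: "'r::ring_1 set \<Rightarrow> bool" where
  "two_sided_ideal J \<longleftrightarrow>
     0 \<in> J \<and> (\<forall>x\<in>J. \<forall>y\<in>J. x + y \<in> J) \<and> (\<forall>a. \<forall>x\<in>J. a * x \<in> J \<and> x * a \<in> J)"

definition quantum_char :: "'k::field \<Rightarrow> nat" where
  "quantum_char q =
     (if \<exists>m>0. (\<Sum>k<m. q ^ k) = 0 then LEAST m. 0 < m \<and> (\<Sum>k<m. q ^ k) = 0 else 0)"

text \<open>
  For \<open>e \<ge> 2\<close> the index set \<open>I\<close> of integers modulo \<open>e\<close> is represented by the residues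
  \<open>{0..<int e}\<close>, and a dominant weight by its coefficients: \<open>\<Lambda> i\<close> is the multiplicity of the
  \<open>i\<close>-th fundamental weight, i.e. the pairing with the \<open>i\<close>-th simple root. Only the values of
  \<open>\<Lambda>\<close> on \<open>{0..<int e}\<close> are used.
\<close>

datatype hecke_gen = GenL nat | GenT nat

text \<open>
  The last two sets of relators kill the letters outside \<open>L\<^sub>1, \<dots>, L\<^sub>n, T\<^sub>1, \<dots>, T\<^sub>n\<^sub>-\<^sub>1\<close>, so that
  the presented algebra is the one on these generators only.
\<close>

definition hecke_relators ::
    "'k::field \<Rightarrow> nat \<Rightarrow> (int \<Rightarrow> nat) \<Rightarrow> nat \<Rightarrow> (hecke_gen, 'k) free_algebra set" where
  "hecke_relators q e \<Lambda> n =
     (let L = (\<lambda>r. free_var (GenL r)); T = (\<lambda>r. free_var (GenT r)); c = free_const in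
        {prod_list (map (\<lambda>i. (L 1 - c (q powi i)) ^ \<Lambda> i) [0..int e - 1])}
      \<union> {L r * L t - L t * L r | r t. r \<in> {1..n} \<and> t \<in> {1..n}}
      \<union> {(T r + 1) * (T r - c q) | r. r \<in> {1..<n}}
      \<union> {T r * L r - L (r + 1) * (T r - c q + 1) | r. r \<in> {1..<n}}
      \<union> {T r * T (r + 1) * T r - T (r + 1) * T r * T (r + 1) | r. r \<in> {1..<n} \<and> r + 1 \<in> {1..<n}}
      \<union> {T r * L t - L t * T r | r t. r \<in> {1..<n} \<and> t \<in> {1..n} \<and> t \<noteq> r \<and> t \<noteq> r + 1}
      \<union> {T r * T t - T t * T r | r t. r \<in> {1..<n} \<and> t \<in> {1..<n} \<and> (r + 1 < t \<or> t + 1 < r)}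
      \<union> {L r | r. r \<notin> {1..n}}
      \<union> {T r | r. r \<notin> {1..<n}})"

locale field_algebra = vector_space scale
  for scale :: "'k::field \<Rightarrow> 'a::ring_1 \<Rightarrow> 'a" (infixr "*s" 75) +
  assumes scale_mult_left: "(c *s x) * y = c *s (x * y)"
    and scale_mult_right: "x * (c *s y) = c *s (x * y)"

definition ring_inv :: "'a::ring_1 \<Rightarrow> 'a" where
  "ring_inv x = (THE y. x * y = 1 \<and> y * x = 1)"

definition residue_seqs :: "nat \<Rightarrow> nat \<Rightarrow> (nat \<Rightarrow> int) set" where
  "residue_seqs e n = {1..n} \<rightarrow>\<^sub>E {0..<int e}"

definition cartan :: "nat \<Rightarrow> int \<Rightarrow> int \<Rightarrow> int" where
  "cartan e i j =
     (if i = j then 2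
      else if e = 2 then -2
      else if i = (j + 1) mod int e \<or> j = (i + 1) mod int e then -1
      else 0)"

definition simple_word_perm :: "nat list \<Rightarrow> nat \<Rightarrow> nat" where
  "simple_word_perm ks = foldr (\<lambda>k f. transpose k (Suc k) \<circ> f) ks id"

definition perm_length :: "nat \<Rightarrow> (nat \<Rightarrow> nat) \<Rightarrow> nat" where
  "perm_length n w =
     (LEAST l. \<exists>ks. set ks \<subseteq> {1..<n} \<and> simple_word_perm ks = w \<and> length ks = l)"

definition reduced_word :: "nat \<Rightarrow> (nat \<Rightarrow> nat) \<Rightarrow> nat list \<Rightarrow> bool" where
  "reduced_word n w ks \<longleftrightarrow>
     set ks \<subseteq> {1..<n} \<and> simple_word_perm ks = w \<and> length ks = perm_length n w"

text \<open>
  The type \<^typ>\<open>'a\<close> is the quotient of the free algebra by the two-sided ideal generated by the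
  relators, with quotient map \<open>proj\<close>.
\<close>

locale cyclotomic_hecke = field_algebra scale
  for scale :: "'k::field \<Rightarrow> 'a::ring_1 \<Rightarrow> 'a" (infixr "*s" 75)
    and proj :: "(hecke_gen, 'k) free_algebra \<Rightarrow> 'a"
    and q :: 'k and e :: nat and \<Lambda> :: "int \<Rightarrow> nat" and n :: nat +
  assumes proj_add: "proj (x + y) = proj x + proj y"
    and proj_mult: "proj (x * y) = proj x * proj y"
    and proj_const: "proj (free_const c) = c *s 1"
    and surj_proj: "surj proj"
    and proj_eq_0_iff: "proj x = 0 \<longleftrightarrow> x \<in> two_sided_ideal hull (hecke_relators q e \<Lambda> n)"
begin

definition L :: "nat \<Rightarrow> 'a" where "L r = proj (free_var (GenL r))"

definition T :: "nat \<Rightarrow> 'a" where "T r = proj (free_var (GenT r))"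

text \<open>All choices of the reduced expression give the same element, by the braid relations.\<close>

definition T_perm :: "(nat \<Rightarrow> nat) \<Rightarrow> 'a" where
  "T_perm w = prod_list (map T (SOME ks. reduced_word n w ks))"

definition weight_space :: "(nat \<Rightarrow> int) \<Rightarrow> 'a set" where
  "weight_space i = {h. \<forall>r\<in>{1..n}. \<exists>N. h * (L r - (q powi i r) *s 1) ^ N = 0}"

definition idem :: "(nat \<Rightarrow> int) \<Rightarrow> 'a" where
  "idem i = (THE x. x * x = x \<and> (\<forall>h. h * x \<in> weight_space i) \<and>
     (\<forall>h\<in>weight_space i. h * x = h) \<and>
     (\<forall>j\<in>residue_seqs e n - {i}. \<forall>h\<in>weight_space j. h * x = 0))"

definition y :: "nat \<Rightarrow> 'a" where
  "y r = (\<Sum>i\<in>residue_seqs e n. (1 - (q powi (- i r)) *s L r) * idem i)"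

text \<open>
  Since \<open>y\<^sub>r\<close> and \<open>y\<^sub>r\<^sub>+\<^sub>1\<close> are nilpotent and commute, a power series in them can be evaluated in the
  algebra, and the inverse of a series with non-zero constant term becomes a ring inverse. The
  series \<open>P\<^sub>r(i)\<close> and \<open>Q\<^sub>r(i)\<close> are those of Brundan and Kleshchev; there
  \<open>Y i r\<close> (written \<open>y\<^sub>r(i)\<close> by them) is the polynomial in \<open>y\<^sub>r\<close> with \<open>L\<^sub>r e(i) = y\<^sub>r(i) e(i)\<close>.
\<close>

definition Y :: "(nat \<Rightarrow> int) \<Rightarrow> nat \<Rightarrow> 'a" where
  "Y i r = (q powi i r) *s (1 - y r)"

definition P :: "nat \<Rightarrow> (nat \<Rightarrow> int) \<Rightarrow> 'a" where
  "P r i =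
     (if i r = i (r + 1) then 1
      else (1 - q) *s ring_inv (1 - Y i r * ring_inv (Y i (r + 1))))"

definition Q :: "nat \<Rightarrow> (nat \<Rightarrow> int) \<Rightarrow> 'a" where
  "Q r i =
     (if i r = i (r + 1) then (1 - q) *s 1 + q *s y (r + 1) - y r
      else if e = 2 then (q powi i r) *s ring_inv (Y i r - Y i (r + 1))
      else if i (r + 1) = (i r + 1) mod int e then
        (Y i r - q *s Y i (r + 1)) * ring_inv ((Y i r - Y i (r + 1)) ^ 2)
      else if i r = (i (r + 1) + 1) mod int e then (q powi i r) *s 1
      else (Y i r - q *s Y i (r + 1)) * ring_inv (Y i r - Y i (r + 1)))"

definition psi :: "nat \<Rightarrow> 'a" where
  "psi r = (\<Sum>i\<in>residue_seqs e n. (T r + P r i) * ring_inv (Q r i) * idem i)"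

inductive hom_monomial :: "int \<Rightarrow> 'a \<Rightarrow> bool" where
  idem: "i \<in> residue_seqs e n \<Longrightarrow> hom_monomial 0 (idem i)"
| y: "r \<in> {1..n} \<Longrightarrow> hom_monomial 2 (y r)"
| psi: "i \<in> residue_seqs e n \<Longrightarrow> r \<in> {1..<n} \<Longrightarrow>
    hom_monomial (- cartan e (i r) (i (r + 1))) (psi r * idem i)"
| mult: "hom_monomial c x \<Longrightarrow> hom_monomial d z \<Longrightarrow> hom_monomial (c + d) (x * z)"

definition graded_component :: "int \<Rightarrow> 'a set" where
  "graded_component d = span {x. hom_monomial d x}"

text \<open>
  The sign \<open>\<epsilon>\<close> is \<open>1\<close> or \<open>-1\<close>. The truncated subtractions of exponents below are genuine
  when \<open>\<Lambda> (s mod int e) > 0\<close>.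
\<close>

definition u :: "int \<Rightarrow> 'a" where
  "u s = prod_list (map (\<lambda>i. prod_list (map (\<lambda>k. L k - (q powi i) *s 1) [1..<n + 1])
                                ^ (\<Lambda> i - of_bool (i = s mod int e))) [0..int e - 1])"

definition x_plus :: 'a where
  "x_plus = (\<Sum>w | w permutes {1..n}. T_perm w)"

definition x_minus :: 'a where
  "x_minus = (\<Sum>w | w permutes {1..n}. ((- q) powi (- int (perm_length n w))) *s T_perm w)"

definition z :: "int \<Rightarrow> int \<Rightarrow> 'a" where
  "z \<epsilon> s = u s * (if \<epsilon> = 1 then x_plus else x_minus)"

definition res_seq :: "int \<Rightarrow> int \<Rightarrow> nat \<Rightarrow> int" where
  "res_seq \<epsilon> s = (\<lambda>k\<in>{1..n}. (s + \<epsilon> * (int k - 1)) mod int e)"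

definition d :: "int \<Rightarrow> int \<Rightarrow> nat \<Rightarrow> nat" where
  "d \<epsilon> s k = \<Lambda> (res_seq \<epsilon> s k) - of_bool (res_seq \<epsilon> s k = s mod int e) + of_bool (e dvd k)"

definition y_prod :: "int \<Rightarrow> int \<Rightarrow> 'a" where
  "y_prod \<epsilon> s = prod_list (map (\<lambda>k. y k ^ d \<epsilon> s k) [1..<n + 1])"

end

end

theory Submission
  imports Defs
begin

text \<open>
  The element \<open>z = u x\<close> is a joint eigenvector. Symmetric polynomials in the \<open>L\<^sub>k\<close> commute with all
  \<open>T\<^sub>r\<close>, hence so does \<open>u\<close>; the cyclotomic relation gives \<open>u (L\<^sub>1 - q\<^sup>s) = 0\<close>; and \<open>x = \<Sum>\<^sub>w t\<^sup>l\<^sup>(\<^sup>w\<^sup>) T\<^sub>w\<close>, with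
  \<open>t = 1\<close> or \<open>t = - q\<^sup>-\<^sup>1\<close>, satisfies \<open>x T\<^sub>r = t q x\<close> (\<open>poincare_eigenvector\<close>). As \<open>q L\<^sub>k\<^sub>+\<^sub>1 = T\<^sub>k L\<^sub>k T\<^sub>k\<close>, one
  finds \<open>z L\<^sub>k = c\<^sub>k z\<close> with \<open>c\<^sub>k = q\<^sup>s\<^sup>+\<^sup>\<epsilon>\<^sup>(\<^sup>k\<^sup>-\<^sup>1\<^sup>)\<close> (\<open>z_part_L\<close>); in particular \<open>z = z e(i)\<close> for the sequence \<open>i\<close> of
  the theorem.

  The same is true of the elements \<open>z\<^sub>m\<close> formed with the first \<open>m\<close> strands, and it turns the coset
  factorization of \<open>S\<^sub>m\<^sub>+\<^sub>1\<close> into a recursion: up to a non-zero scalar, \<open>z\<^sub>m\<^sub>+\<^sub>1\<close> is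
  \<open>z\<^sub>m f(L\<^sub>m\<^sub>+\<^sub>1) (L\<^sub>m\<^sub>+\<^sub>1 - q\<^sup>s\<^sup>-\<^sup>\<epsilon>)\<close>, where \<open>f(L\<^sub>m\<^sub>+\<^sub>1)\<close> is the part of \<open>u\<close> that involves \<open>L\<^sub>m\<^sub>+\<^sub>1\<close>
  (\<open>z_part_step\<close>). So \<open>z\<close> is a scalar times an explicit product of linear factors \<open>L\<^sub>k - q\<^sup>j\<close>, in which
  \<open>L\<^sub>k - c\<^sub>k\<close> occurs \<open>d\<^sub>k\<close> times (\<open>count_linear_factors\<close>).

  Multiply this product by \<open>e(i)\<close>. There \<open>L\<^sub>k - c\<^sub>k\<close> equals \<open>- c\<^sub>k y\<^sub>k\<close>, and the factors with
  \<open>q\<^sup>j \<noteq> c\<^sub>k\<close> can be cancelled. Because \<open>z\<close> is killed by every \<open>L\<^sub>k - c\<^sub>k\<close>, cancellation shows that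
  the product of \<open>e(i)\<close> and the powers of the \<open>y\<^sub>k\<close> is killed as well; on it the cancelled factors are
  therefore non-zero scalars, and the two elements are proportional (\<open>z_eq_idem_y_prod\<close>). The degree is
  then read off from the right-hand side.

  Two foundations carry this. The elements \<open>T\<^sub>w\<close> do not depend on the reduced word (\<open>normalize_word\<close>), which
  is proved with a normal form adapted to the coset factorization. And the idempotents \<open>e(i)\<close> exist
  (\<open>idem_exists\<close>), because an intertwiner transports the cyclotomic relation from \<open>L\<^sub>1\<close> to all \<open>L\<^sub>r\<close>
  (\<open>spectral_nilpotent\<close>) and the resulting linear factors are comaximal.
\<close>

section \<open>Braid moves and normal forms of permutations\<close>

text \<open>
  Words in the simple transpositions up to the braid relations alone, without \<open>s\<^sub>i\<^sup>2 = 1\<close>: equivalent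
  words give the same product in every monoid whose generators satisfy the braid relations.
\<close>

inductive braid_equiv :: "nat list \<Rightarrow> nat list \<Rightarrow> bool" (infix "\<approx>" 50) where
  refl: "xs \<approx> xs"
| sym: "xs \<approx> ys \<Longrightarrow> ys \<approx> xs"
| trans [trans]: "xs \<approx> ys \<Longrightarrow> ys \<approx> zs \<Longrightarrow> xs \<approx> zs"
| comm: "r + 1 < t \<Longrightarrow> xs @ [r, t] @ ys \<approx> xs @ [t, r] @ ys"
| braid: "xs @ [r, r + 1, r] @ ys \<approx> xs @ [r + 1, r, r + 1] @ ys"

lemma braid_equiv_append: "xs \<approx> ys \<Longrightarrow> as @ xs @ bs \<approx> as @ ys @ bs"
proof (induction rule: braid_equiv.induct)
  case (comm r t xs ys)
  then show ?case using braid_equiv.comm[of r t "as @ xs" "ys @ bs"] by simp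
next
  case (braid xs r ys)
  then show ?case using braid_equiv.braid[of "as @ xs" r "ys @ bs"] by simp
qed (auto intro: braid_equiv.intros)

lemma braid_equiv_length: "xs \<approx> ys \<Longrightarrow> length xs = length ys"
  by (induction rule: braid_equiv.induct) auto

lemma simple_word_perm_Nil [simp]: "simple_word_perm [] = id"
  and simple_word_perm_Cons:
    "simple_word_perm (k # ks) = transpose k (Suc k) \<circ> simple_word_perm ks"
  by (simp_all add: simple_word_perm_def)

lemma simple_word_perm_append:
  "simple_word_perm (xs @ ys) = simple_word_perm xs \<circ> simple_word_perm ys"
  by (induction xs) (simp_all add: simple_word_perm_Cons comp_assoc)

lemma braid_equiv_perm: "xs \<approx> ys \<Longrightarrow> simple_word_perm xs = simple_word_perm ys"
proof (induction rule: braid_equiv.induct)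
  case (comm r t xs ys)
  have "transpose r (Suc r) \<circ> transpose t (Suc t) = transpose t (Suc t) \<circ> transpose r (Suc r)"
    using comm by (auto simp: fun_eq_iff transpose_def)
  then show ?case
    by (simp add: simple_word_perm_append simple_word_perm_Cons flip: comp_assoc)
next
  case (braid xs r ys)
  have "simple_word_perm [r, r + 1, r] = simple_word_perm [r + 1, r, r + 1]"
    by (auto simp: fun_eq_iff transpose_def simple_word_perm_Cons)
  then show ?case
    by (simp only: simple_word_perm_append)
qed auto

lemma simple_word_perm_permutes:
  "set ks \<subseteq> {1..<m} \<Longrightarrow> simple_word_perm ks permutes {1..m}"
  by (induction ks)
     (auto simp: simple_word_perm_Cons intro!: permutes_compose permutes_swap_id)

lemma braid_equiv_move:
  assumes "\<forall>x\<in>set xs. r + 1 < x \<or> x + 1 < r"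
  shows "xs @ [r] \<approx> r # xs"
  using assms
proof (induction xs)
  case Nil
  then show ?case by (simp add: braid_equiv.refl)
next
  case (Cons x xs)
  have "x # xs @ [r] \<approx> x # r # xs"
    using braid_equiv_append[of "xs @ [r]" "r # xs" "[x]" "[]"] Cons by simp
  also have "\<dots> \<approx> r # x # xs"
    using braid_equiv.comm[of r x "[]" xs] braid_equiv.sym[OF braid_equiv.comm[of x r "[]" xs]] Cons.prems
    by (auto intro: braid_equiv.sym)
  finally show ?case by simp
qed

definition descending :: "nat \<Rightarrow> nat \<Rightarrow> nat list" where
  "descending m k = rev [k..<Suc m]"

lemma set_descending [simp]: "set (descending m k) = {k..m}"
  by (auto simp: descending_def)

lemma length_descending [simp]: "length (descending m k) = Suc m - k"
  by (simp add: descending_def del: upt_Suc)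

lemma descending_empty [simp]: "m < k \<Longrightarrow> descending m k = []"
  by (simp add: descending_def)

lemma descending_Suc: "k \<le> Suc m \<Longrightarrow> descending (Suc m) k = Suc m # descending m k"
  by (simp add: descending_def)

lemma descending_snoc: "k \<le> m \<Longrightarrow> descending m k = descending m (Suc k) @ [k]"
  by (simp add: descending_def upt_rec del: upt_Suc)

text \<open>
  The word \<open>m (m-1) \<dots> k\<close> shifts the letter above \<open>r\<close> down by one: move \<open>r + 1\<close> left past the
  letters below \<open>r\<close>, apply one braid relation to \<open>(r+1) r (r+1)\<close>, and move \<open>r\<close> left past the rest.
\<close>

lemma descending_braid:
  assumes "k \<le> r" "r < m"
  shows "descending m k @ [Suc r] \<approx> r # descending m k"
proof -
  let ?u = "descending m (r + 2)" and ?v = "rev [k..<r]"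
  have "[k..<Suc m] = [k..<r] @ [r..<Suc m]"
    using assms upt_add_eq_append[of k r "Suc m - r"] by simp
  moreover have "[r..<Suc m] = r # Suc r # [r+2..<Suc m]"
    using assms by (simp add: upt_rec[of r] upt_rec[of "Suc r"] del: upt_Suc)
  ultimately have dec: "descending m k = ?u @ [r + 1, r] @ ?v"
    by (simp add: descending_def del: upt_Suc)
  have "?u @ [r + 1, r] @ ?v @ [r + 1] \<approx> ?u @ [r + 1, r] @ (r + 1) # ?v"
    using braid_equiv_append[OF braid_equiv_move[of ?v "r + 1"], of "?u @ [r + 1, r]" "[]"] by auto
  also have "\<dots> \<approx> (?u @ [r]) @ ([r + 1, r] @ ?v)"
    using braid_equiv.sym[OF braid_equiv.braid[of ?u r ?v]] by simp
  also have "\<dots> \<approx> r # ?u @ [r + 1, r] @ ?v"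
    using braid_equiv_append[OF braid_equiv_move[of ?u r], of "[]" "[r + 1, r] @ ?v"] by auto
  finally show ?thesis by (simp add: dec)
qed

text \<open>
  One word per permutation: \<open>v\<close> runs through the normal words of \<open>S\<^sub>m\<close> and the descending words
  through minimal representatives of the right cosets of \<open>S\<^sub>m\<close> in \<open>S\<^sub>m\<^sub>+\<^sub>1\<close>.
\<close>

fun normal_words :: "nat \<Rightarrow> nat list set" where
  "normal_words 0 = {[]}"
| "normal_words (Suc m) = (\<lambda>(v, k). v @ descending m k) ` (normal_words m \<times> {1..Suc m})"

lemma normal_words_letters: "ks \<in> normal_words m \<Longrightarrow> set ks \<subseteq> {1..<m}"
  by (induction m arbitrary: ks) fastforce+

text \<open>
  Right multiplication by a letter leads, through braid moves only, from a normal word to a normal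
  word whose length is larger or smaller by one. A letter either passes through the descending part,
  which leaves a letter for \<open>v\<close> and the induction hypothesis, or it extends or shortens that part.
\<close>

lemma normal_words_step:
  assumes "ks \<in> normal_words m" "r \<in> {1..<m}"
  shows "\<exists>ks'\<in>normal_words m. ks @ [r] \<approx> ks' \<or> ks \<approx> ks' @ [r]"
  using assms
proof (induction m arbitrary: ks r)
  case 0
  then show ?case by simp
next
  case (Suc m)
  obtain v k where ks: "ks = v @ descending m k" and v: "v \<in> normal_words m" and k: "k \<in> {1..Suc m}"
    using Suc.prems(1) by auto
  have r: "1 \<le> r" "r \<le> m" using Suc.prems(2) by auto
  have D: "descending m r = descending m (Suc r) @ [r]"
    using r by (simp add: descending_snoc)
  have in_nf: "v' @ descending m k' \<in> normal_words (Suc m)"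
    if "v' \<in> normal_words m" "k' \<in> {1..Suc m}" for v' k'
    using that by (force)
  have pass: ?case if r': "r' \<in> {1..<m}" and eq: "descending m k @ [r] \<approx> r' # descending m k" for r'
  proof -
    obtain v' where v': "v' \<in> normal_words m" "v @ [r'] \<approx> v' \<or> v \<approx> v' @ [r']"
      using Suc.IH[OF v r'] by blast
    have e1: "ks @ [r] \<approx> (v @ [r']) @ descending m k"
      using braid_equiv_append[OF eq, of v "[]"] by (simp add: ks)
    have e2: "v' @ r' # descending m k \<approx> (v' @ descending m k) @ [r]"
      using braid_equiv_append[OF braid_equiv.sym[OF eq], of v' "[]"] by simp
    show ?thesis
      using v'(2)
    proof
      assume "v @ [r'] \<approx> v'"
      then have "(v @ [r']) @ descending m k \<approx> v' @ descending m k"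
        using braid_equiv_append[of "v @ [r']" v' "[]"] by simp
      then show ?thesis
        using in_nf[OF v'(1) k] braid_equiv.trans[OF e1] by blast
    next
      assume "v \<approx> v' @ [r']"
      then have "ks \<approx> v' @ r' # descending m k"
        using braid_equiv_append[of v "v' @ [r']" "[]" "descending m k"] by (simp add: ks)
      then show ?thesis
        using in_nf[OF v'(1) k] braid_equiv.trans[OF _ e2] by blast
    qed
  qed
  consider "r + 1 < k" | "k = r + 1" | "k = r" | "k < r" by linarith
  then show ?case
  proof cases
    case 1
    then show ?thesis
      using k r by (intro pass[of r]) (auto intro!: braid_equiv_move)
  next
    case 2
    have "ks @ [r] \<approx> v @ descending m r"
      using 2 D by (simp add: ks braid_equiv.refl)
    moreover have "v @ descending m r \<in> normal_words (Suc m)"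
      using r by (intro in_nf v) auto
    ultimately show ?thesis by blast
  next
    case 3
    have "ks \<approx> (v @ descending m (Suc r)) @ [r]"
      using 3 D by (simp add: ks braid_equiv.refl)
    moreover have "v @ descending m (Suc r) \<in> normal_words (Suc m)"
      using r by (intro in_nf v) auto
    ultimately show ?thesis by blast
  next
    case 4
    then show ?thesis
      using k r descending_braid[of k "r - 1" m] by (intro pass[of "r - 1"]) auto
  qed
qed

text \<open>
  This is Matsumoto's theorem in the form used here. Reading the word from the left, the normal form
  of the prefix read so far grows by at most one letter at each step; if no length is lost in the end,
  each step went up, and then only braid moves were made.
\<close>

lemma normalize_word:
  assumes "set ks \<subseteq> {1..<m}"
  obtains v where "v \<in> normal_words m" "simple_word_perm v = simple_word_perm ks"
    "length v \<le> length ks" "length v = length ks \<Longrightarrow> ks \<approx> v"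
proof -
  have "\<exists>v\<in>normal_words m. simple_word_perm v = simple_word_perm ks \<and> length v \<le> length ks \<and>
          (length v = length ks \<longrightarrow> ks \<approx> v)"
    using assms
  proof (induction ks rule: rev_induct)
    case Nil
    have "[] \<in> normal_words m"
      by (induction m) (force simp: image_iff)+
    then show ?case by (auto intro: braid_equiv.refl)
  next
    case (snoc r ks)
    then obtain v where v: "v \<in> normal_words m" "simple_word_perm v = simple_word_perm ks"
      "length v \<le> length ks" "length v = length ks \<longrightarrow> ks \<approx> v" and r: "r \<in> {1..<m}"
      by auto
    obtain v' where v': "v' \<in> normal_words m" "v @ [r] \<approx> v' \<or> v \<approx> v' @ [r]"
      using normal_words_step[OF v(1) r] by blast
    show ?case
      using v'(2)
    proof
      assume up: "v @ [r] \<approx> v'"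
      have "ks @ [r] \<approx> v'" if "length v = length ks"
        using braid_equiv.trans[OF braid_equiv_append[of ks v "[]" "[r]", simplified] up] v(4) that by blast
      then show ?thesis
        using v'(1) v(2,3) braid_equiv_length[OF up] braid_equiv_perm[OF up]
        by (auto simp: simple_word_perm_append intro!: bexI[of _ v'])
    next
      assume down: "v \<approx> v' @ [r]"
      have "simple_word_perm ks \<circ> transpose r (Suc r) =
          simple_word_perm v' \<circ> (transpose r (Suc r) \<circ> transpose r (Suc r))"
        using v(2)[symmetric] braid_equiv_perm[OF down]
        by (simp add: simple_word_perm_append simple_word_perm_Cons comp_assoc del: transpose_comp_involutory)
      then show ?thesis
        using v'(1) v(3) braid_equiv_length[OF down]
        by (auto simp: simple_word_perm_append simple_word_perm_Cons intro!: bexI[of _ v'])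
    qed
  qed
  then show thesis using that by blast
qed

lemma descending_perm_apply:
  assumes "k \<le> Suc m"
  shows "simple_word_perm (descending m k) k = Suc m"
  using assms
proof (induction m)
  case 0
  then show ?case by (cases k) (auto simp: descending_def simple_word_perm_Cons)
next
  case (Suc m)
  then show ?case
    by (cases "k = Suc (Suc m)") (auto simp: descending_Suc simple_word_perm_Cons)
qed

text \<open>
  The descending word from \<open>m\<close> to \<open>k\<close> sends \<open>k\<close> to \<open>m + 1\<close>, whereas \<open>v\<close> fixes \<open>m + 1\<close>. So
  \<open>k\<close> is the preimage of \<open>m + 1\<close> under the permutation, and \<open>v\<close> is determined by what remains.
\<close>

lemma normal_words_bij:
  "bij_betw (\<lambda>(v, k). v @ descending m k) (normal_words m \<times> {1..Suc m}) (normal_words (Suc m))"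
  "bij_betw simple_word_perm (normal_words m) {w. w permutes {1..m}}"
proof -
  have *: "bij_betw simple_word_perm (normal_words m) {w. w permutes {1..m}} \<and>
     inj_on (\<lambda>(v, k). v @ descending m k) (normal_words m \<times> {1..Suc m})" for m
  proof (induction m)
    case 0
    have "{w. w permutes {}} = {id}" by auto
    then show ?case by (auto simp: bij_betw_def inj_on_def)
  next
    case (Suc m)
    let ?f = "\<lambda>m (v, k). v @ descending m k" and ?c = "\<lambda>k. simple_word_perm (descending m k)"
    have inj1: "inj_on (\<lambda>x. simple_word_perm (?f m x)) (normal_words m \<times> {1..Suc m})"
      if bij: "bij_betw simple_word_perm (normal_words m) {w. w permutes {1..m}}" for m
    proof (rule inj_onI, clarify)
      fix v k v' k'
      assume v: "v \<in> normal_words m" "v' \<in> normal_words m" and k: "k \<in> {1..Suc m}" "k' \<in> {1..Suc m}"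
        and eq: "simple_word_perm (v @ descending m k) = simple_word_perm (v' @ descending m k')"
      let ?c = "\<lambda>k. simple_word_perm (descending m k)"
      have pv: "simple_word_perm v permutes {1..m}" "simple_word_perm v' permutes {1..m}"
        using bij v by (auto simp: bij_betw_def)
      have pc: "?c k' permutes {1..Suc m}"
        using k by (intro simple_word_perm_permutes) auto
      have "simple_word_perm v (?c k k) = simple_word_perm v' (?c k' k)"
        using fun_cong[OF eq, of k] by (simp add: simple_word_perm_append)
      moreover have "simple_word_perm v (Suc m) = Suc m" "simple_word_perm v' (Suc m) = Suc m"
        using pv by (auto simp: permutes_def)
      ultimately have "simple_word_perm v' (?c k' k) = simple_word_perm v' (Suc m)"
        using k by (simp add: descending_perm_apply)
      then have "?c k' k = ?c k' k'"
        using k inj_eq[OF permutes_inj[OF pv(2)]] by (simp add: descending_perm_apply)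
      then have kk: "k = k'"
        using inj_eq[OF permutes_inj[OF pc]] by metis
      have "simple_word_perm v \<circ> ?c k' \<circ> inv (?c k') = simple_word_perm v' \<circ> ?c k' \<circ> inv (?c k')"
        using eq kk by (simp add: simple_word_perm_append)
      then have "simple_word_perm v = simple_word_perm v'"
        by (simp add: comp_assoc permutes_inv_o[OF pc])
      then show "v = v' \<and> k = k'"
        using bij v kk by (auto simp: bij_betw_def inj_on_def)
    qed
    have surj: "w \<in> simple_word_perm ` normal_words (Suc m)" if w: "w permutes {1..Suc m}" for w
    proof -
      define k where "k = inv w (Suc m)"
      have k: "k \<in> {1..Suc m}"
        using permutes_in_image[OF permutes_inv[OF w], of "Suc m"] by (simp add: k_def)
      have pc: "?c k permutes {1..Suc m}"
        using k by (intro simple_word_perm_permutes) auto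
      define v where "v = w \<circ> inv (?c k)"
      have pv: "v permutes {1..Suc m}"
        unfolding v_def using pc w by (intro permutes_compose permutes_inv)
      have "inv (?c k) (Suc m) = k"
        using permutes_inverses(2)[OF pc, of k] k by (simp add: descending_perm_apply)
      then have "v (Suc m) = Suc m"
        using permutes_inverses(1)[OF w] by (simp add: v_def k_def)
      then have "v permutes {1..m}"
        using pv by (intro permutes_superset[OF pv]) (auto simp: le_Suc_eq)
      then obtain v' where v': "v' \<in> normal_words m" "v = simple_word_perm v'"
        using Suc by (auto simp: bij_betw_def)
      have "w = v \<circ> ?c k"
        by (simp add: v_def comp_assoc permutes_inv_o[OF pc])
      then have "w = simple_word_perm (v' @ descending m k)"
        by (simp add: v' simple_word_perm_append)
      then show ?thesis
        using v' k by (force)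
    qed
    have "inj_on simple_word_perm (normal_words (Suc m))"
      using inj1[of m] Suc unfolding normal_words.simps
      by (intro inj_on_imageI) (auto simp: comp_def)
    then have bij: "bij_betw simple_word_perm (normal_words (Suc m)) {w. w permutes {1..Suc m}}"
      using surj simple_word_perm_permutes[OF normal_words_letters]
      by (auto simp: bij_betw_def simp del: normal_words.simps)
    have "inj_on (?f (Suc m)) (normal_words (Suc m) \<times> {1..Suc (Suc m)})"
      using inj_on_imageI2[of simple_word_perm "?f (Suc m)" "normal_words (Suc m) \<times> {1..Suc (Suc m)}"]
        inj1[OF bij] by (simp only: comp_def)
    then show ?case using bij by blast
  qed
  then show "bij_betw simple_word_perm (normal_words m) {w. w permutes {1..m}}" by blast
  show "bij_betw (\<lambda>(v, k). v @ descending m k) (normal_words m \<times> {1..Suc m}) (normal_words (Suc m))"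
    using * by (simp add: bij_betw_def)
qed

lemma reduced_word_normal:
  assumes v: "v \<in> normal_words m"
  shows "perm_length m (simple_word_perm v) = length v"
    and "reduced_word m (simple_word_perm v) ks \<Longrightarrow> ks \<approx> v"
    and "reduced_word m (simple_word_perm v) v"
proof -
  have norm: "length v \<le> length ks \<and> (length v = length ks \<longrightarrow> ks \<approx> v)"
    if ks: "set ks \<subseteq> {1..<m}" "simple_word_perm ks = simple_word_perm v" for ks
  proof -
    obtain v' where v': "v' \<in> normal_words m" "simple_word_perm v' = simple_word_perm ks"
      "length v' \<le> length ks" "length v' = length ks \<Longrightarrow> ks \<approx> v'"
      using normalize_word[OF ks(1)] by blast
    then have "v' = v"
      using normal_words_bij(2)[of m] v ks(2) by (auto simp: bij_betw_def inj_on_def)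
    then show ?thesis using v' by blast
  qed
  show len: "perm_length m (simple_word_perm v) = length v"
    unfolding perm_length_def
    using norm normal_words_letters[OF v] by (intro Least_equality) auto
  show "reduced_word m (simple_word_perm v) ks \<Longrightarrow> ks \<approx> v"
    using norm by (auto simp: reduced_word_def len)
  show "reduced_word m (simple_word_perm v) v"
    using normal_words_letters[OF v] by (auto simp: reduced_word_def len)
qed

section \<open>Commuting elements and generalized eigenspaces\<close>

lemma (in field_algebra) prod_list_scale:
  "prod_list (map (\<lambda>x. c *s f x) xs) = c ^ length xs *s prod_list (map f xs)"
  by (induction xs) (simp_all add: scale_mult_left scale_mult_right mult.commute)

text \<open>
  The elements \<open>L\<^sub>r\<close> commute inside a noncommutative ring. A commutative subalgebra, given as a set,
  makes rewriting by commutativity conditional on membership.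
\<close>

locale commutative_subalgebra = field_algebra scale
  for scale :: "'k::field \<Rightarrow> 'a::ring_1 \<Rightarrow> 'a" (infixr "*s" 75) +
  fixes A :: "'a set"
  assumes one_mem [simp, intro]: "1 \<in> A"
    and add_mem [simp, intro]: "a \<in> A \<Longrightarrow> b \<in> A \<Longrightarrow> a + b \<in> A"
    and mult_mem [simp, intro]: "a \<in> A \<Longrightarrow> b \<in> A \<Longrightarrow> a * b \<in> A"
    and scale_mem [simp, intro]: "a \<in> A \<Longrightarrow> c *s a \<in> A"
    and commute: "a \<in> A \<Longrightarrow> b \<in> A \<Longrightarrow> a * b = b * a"
begin

lemma zero_mem [simp, intro]: "0 \<in> A"
  using scale_mem[OF one_mem, of 0] by simp

lemma diff_mem [simp, intro]: "a \<in> A \<Longrightarrow> b \<in> A \<Longrightarrow> a - b \<in> A"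
  using add_mem[of a "(-1) *s b"] scale_mem[of b "-1"] by simp

lemma power_mem [simp, intro]: "a \<in> A \<Longrightarrow> a ^ k \<in> A"
  by (induction k) auto

lemma prod_list_mem: "(\<And>x. x \<in> set xs \<Longrightarrow> f x \<in> A) \<Longrightarrow> prod_list (map f xs) \<in> A"
  by (induction xs) auto

lemma left_commute: "a \<in> A \<Longrightarrow> b \<in> A \<Longrightarrow> a * (b * c) = b * (a * c)"
  by (metis commute mult.assoc)

lemmas ac = mult.assoc commute left_commute

lemma power_mult: "a \<in> A \<Longrightarrow> b \<in> A \<Longrightarrow> (a * b) ^ k = a ^ k * b ^ k"
  by (induction k) (simp_all add: ac)

lemma prod_list_mult:
  assumes "\<And>x. x \<in> set xs \<Longrightarrow> f x \<in> A" "\<And>x. x \<in> set xs \<Longrightarrow> g x \<in> A"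
  shows "prod_list (map (\<lambda>x. f x * g x) xs) = prod_list (map f xs) * prod_list (map g xs)"
  using assms by (induction xs) (simp_all add: ac prod_list_mem)

lemma prod_list_partition:
  assumes "\<And>x. x \<in> set xs \<Longrightarrow> f x \<in> A"
  shows "prod_list (map f xs) =
    prod_list (map f (filter R xs)) * prod_list (map f (filter (\<lambda>x. \<not> R x) xs))"
  using assms
proof (induction xs)
  case (Cons x xs)
  have "prod_list (map f (filter R xs)) \<in> A" "f x \<in> A"
    using Cons.prems by (auto intro!: prod_list_mem)
  then show ?case
    using Cons by (simp add: mult.assoc left_commute[of "f x" "prod_list (map f (filter R xs))"])
qed simp

lemma prod_list_power:
  "(\<And>x. x \<in> set xs \<Longrightarrow> f x \<in> A) \<Longrightarrow> prod_list (map f xs) ^ k = prod_list (map (\<lambda>x. f x ^ k) xs)"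
  by (induction xs) (simp_all add: power_mult prod_list_mem)

lemma prod_list_raise:
  assumes "distinct xs" "x \<in> set xs" "\<And>y. y \<in> set xs \<Longrightarrow> f y \<in> A" "0 < \<mu> x"
  shows "prod_list (map (\<lambda>y. f y ^ (\<mu> y - of_bool (y = x))) xs) * f x = prod_list (map (\<lambda>y. f y ^ \<mu> y) xs)"
  using assms(1-3)
proof (induction xs)
  case (Cons z xs)
  have xs: "prod_list (map (\<lambda>y. f y ^ \<nu> y) xs) \<in> A" for \<nu>
    using Cons.prems by (intro prod_list_mem) auto
  show ?case
  proof (cases "z = x")
    case True
    then have "map (\<lambda>y. f y ^ (\<mu> y - of_bool (y = x))) xs = map (\<lambda>y. f y ^ \<mu> y) xs"
      using Cons.prems by auto
    then have "prod_list (map (\<lambda>y. f y ^ (\<mu> y - of_bool (y = x))) xs) = prod_list (map (\<lambda>y. f y ^ \<mu> y) xs)"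
      by (rule arg_cong)
    moreover have "f x ^ (\<mu> x - Suc 0) * f x = f x ^ \<mu> x"
      using assms(4) by (metis Suc_pred power_Suc2)
    ultimately show ?thesis
      using True Cons.prems xs[of \<mu>]
      by (simp add: mult.assoc commute[of "prod_list _" "f x"]) (simp flip: mult.assoc)
  next
    case False
    then show ?thesis
      using Cons by (simp add: mult.assoc)
  qed
qed simp

definition comaximal :: "'a \<Rightarrow> 'a \<Rightarrow> bool" where
  "comaximal x y \<longleftrightarrow> (\<exists>g\<in>A. \<exists>h\<in>A. x * g + y * h = 1)"

lemma comaximal_sym: "comaximal x y \<Longrightarrow> comaximal y x"
  unfolding comaximal_def by (metis add.commute)

lemma comaximal_mult:
  assumes "comaximal x y" "comaximal x z" "x \<in> A" "y \<in> A" "z \<in> A"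
  shows "comaximal x (y * z)"
proof -
  obtain g h where gh: "g \<in> A" "h \<in> A" "x * g + y * h = 1"
    using assms(1) comaximal_def by blast
  obtain g' h' where gh': "g' \<in> A" "h' \<in> A" "x * g' + z * h' = 1"
    using assms(2) comaximal_def by blast
  have "1 = (x * g + y * h) * (x * g' + z * h')"
    using gh gh' by simp
  also have "\<dots> = x * (g * (x * g') + g * (z * h') + y * h * g') + (y * z) * (h * h')"
    using assms(3-5) gh(1,2) gh'(1,2) by (simp add: distrib_left distrib_right ac add.assoc)
  finally show ?thesis
    unfolding comaximal_def using assms(3-5) gh gh'
    by (metis add_mem mult_mem)
qed

lemma comaximal_one: "x \<in> A \<Longrightarrow> comaximal x 1"
  unfolding comaximal_def by (intro bexI[of _ 0] bexI[of _ 1]) auto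

lemma comaximal_power: "comaximal x y \<Longrightarrow> x \<in> A \<Longrightarrow> y \<in> A \<Longrightarrow> comaximal x (y ^ k)"
  by (induction k) (auto intro: comaximal_mult comaximal_one)

lemma comaximal_prod_list:
  "(\<And>z. z \<in> set zs \<Longrightarrow> f z \<in> A \<and> comaximal x (f z)) \<Longrightarrow> x \<in> A \<Longrightarrow>
    comaximal x (prod_list (map f zs))"
  by (induction zs) (auto intro!: comaximal_mult comaximal_one prod_list_mem)

text \<open>
  Different scalars make \<open>X - a\<close> and \<open>X - b\<close> comaximal because their difference is a unit, and
  comaximality passes to powers.
\<close>

lemma comaximal_linear_factors:
  assumes "X \<in> A" "a \<noteq> b"
  shows "comaximal ((X - a *s 1) ^ N) ((X - b *s 1) ^ M)"
proof -
  have "(X - a *s 1) * (1 / (b - a)) *s 1 + (X - b *s 1) * (- (1 / (b - a))) *s 1 =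
      (b / (b - a) - a / (b - a)) *s 1"
    by (simp add: scale_mult_right scale_right_diff_distrib scale_left_diff_distrib)
  also have "\<dots> = 1"
    using assms(2) by (simp flip: diff_divide_distrib)
  finally have "comaximal (X - a *s 1) (X - b *s 1)"
    unfolding comaximal_def by (metis one_mem scale_mem)
  then show ?thesis
    by (meson assms(1) comaximal_power comaximal_sym diff_mem one_mem power_mem scale_mem)
qed

lemma comaximal_kills:
  assumes "comaximal x y" "h * x = 0" "h * y = 0"
  shows "h = 0"
proof -
  obtain g g' where "x * g + y * g' = 1"
    using assms(1) comaximal_def by blast
  then have "h = h * x * g + h * y * g'"
    by (metis distrib_left mult.assoc mult.right_neutral)
  then show ?thesis using assms by simp
qed

lemma generalized_eigenspaces_disjoint:
  assumes "X \<in> A" "a \<noteq> b" "h * (X - a *s 1) ^ N = 0" "h * (X - b *s 1) ^ M = 0"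
  shows "h = 0"
  using comaximal_kills[OF comaximal_linear_factors] assms by blast

text \<open>
  The primary decomposition without a vector space: each linear factor is split off by a comaximality
  identity, so the summands stay in the subalgebra.
\<close>

lemma generalized_eigenspace_decomposition:
  assumes "X \<in> A" "inj_on \<phi> (set is)" "distinct is" "h \<in> A"
    and "h * prod_list (map (\<lambda>i. (X - \<phi> i *s 1) ^ N) is) = 0"
  shows "\<exists>f. (\<forall>i\<in>set is. f i \<in> A \<and> f i * (X - \<phi> i *s 1) ^ N = 0) \<and> (\<Sum>i\<in>set is. f i) = h"
  using assms(2-5)
proof (induction "is" arbitrary: h)
  case Nil
  then show ?case by simp
next
  case (Cons j "is")
  define x where "x = (X - \<phi> j *s 1) ^ N"
  define y where "y = prod_list (map (\<lambda>i. (X - \<phi> i *s 1) ^ N) is)"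
  have x: "x \<in> A" and y: "y \<in> A"
    using assms(1) by (auto simp: x_def y_def intro!: prod_list_mem)
  have "comaximal x y"
    unfolding x_def y_def using Cons.prems assms(1)
    by (intro comaximal_prod_list conjI comaximal_linear_factors) (auto simp: inj_on_def)
  then obtain g g' where g: "g \<in> A" "g' \<in> A" "x * g + y * g' = 1"
    using comaximal_def by blast
  have hxy: "h * x * y = 0"
    using Cons.prems by (simp add: x_def y_def mult.assoc)
  have "(h * x * g) * y = (h * x * y) * g"
    using x y g Cons.prems by (simp add: ac)
  then have "(h * x * g) * y = 0" by (simp add: hxy)
  then obtain f where f: "\<forall>i\<in>set is. f i \<in> A \<and> f i * (X - \<phi> i *s 1) ^ N = 0"
    "(\<Sum>i\<in>set is. f i) = h * x * g"
    using Cons.IH[of "h * x * g"] Cons.prems x g by (auto simp: y_def)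
  have "(h * y * g') * x = (h * x * y) * g'"
    using x y g Cons.prems by (simp add: ac)
  then have k: "(h * y * g') * x = 0" by (simp add: hxy)
  have nj: "j \<notin> set is" using Cons.prems by simp
  have "h = h * x * g + h * y * g'"
    using g(3) by (metis distrib_left mult.assoc mult.right_neutral)
  moreover have "(\<Sum>i\<in>set is. (f(j := h * y * g')) i) = (\<Sum>i\<in>set is. f i)"
    using nj by (intro sum.cong) auto
  ultimately have "(\<Sum>i\<in>set (j # is). (f(j := h * y * g')) i) = h"
    using nj f(2) by (simp add: add.commute)
  moreover have "\<forall>i\<in>set (j # is). (f(j := h * y * g')) i \<in> A \<and> (f(j := h * y * g')) i * (X - \<phi> i *s 1) ^ N = 0"
    using f(1) k Cons.prems y g nj by (auto simp: x_def)
  ultimately show ?case by blast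
qed

lemma nilpotent_mult:
  assumes "D ^ M = E * g" "E ^ N = 0" "E \<in> A" "g \<in> A"
  shows "D ^ (M * N) = 0"
  using assms by (simp add: power_mult Power.power_mult)

text \<open>
  A polynomial satisfies \<open>x - y dvd p x - p y\<close> at commuting arguments; here for a polynomial given
  by its linear factors.
\<close>

lemma prod_linear_diff_dvd:
  assumes "x \<in> A" "y \<in> A"
  shows "\<exists>g\<in>A. prod_list (map (\<lambda>i. x - \<phi> i *s 1) is) - prod_list (map (\<lambda>i. y - \<phi> i *s 1) is) = (x - y) * g"
proof (induction "is")
  case Nil
  show ?case by (auto intro!: bexI[of _ 0])
next
  case (Cons i "is")
  let ?p = "\<lambda>x. prod_list (map (\<lambda>i. x - \<phi> i *s 1) is)"
  have p: "?p x \<in> A" using assms by (intro prod_list_mem) auto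
  obtain g where g: "g \<in> A" "?p x - ?p y = (x - y) * g" using Cons by blast
  have "(x - \<phi> i *s 1) * ?p x - (y - \<phi> i *s 1) * ?p y =
      (x - y) * ?p x + (y - \<phi> i *s 1) * (?p x - ?p y)"
    by (simp add: algebra_simps)
  also have "\<dots> = (x - y) * (?p x + (y - \<phi> i *s 1) * g)"
    unfolding g(2) using assms g(1) p by (subst left_commute) (auto simp: distrib_left)
  finally show ?case
    using assms g p by (auto intro!: bexI[of _ "?p x + (y - \<phi> i *s 1) * g"])
qed

end

text \<open>
  For a commuting set this is a commutative subalgebra that contains the set; membership in it is
  checked without writing elements as polynomials in the generators.
\<close>

definition bicommutant :: "'a::ring_1 set \<Rightarrow> 'a set" where
  "bicommutant G = {a. \<forall>b. (\<forall>g\<in>G. b * g = g * b) \<longrightarrow> b * a = a * b}"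

lemma (in field_algebra) bicommutant_subalgebra:
  assumes "\<And>g h. g \<in> G \<Longrightarrow> h \<in> G \<Longrightarrow> g * h = h * g"
  shows "commutative_subalgebra scale (bicommutant G)"
proof
  fix a b c assume a: "a \<in> bicommutant G" and b: "b \<in> bicommutant G"
  show "a * b \<in> bicommutant G"
    using a b unfolding bicommutant_def by (auto simp: mult.assoc) (metis mult.assoc)
  have "a * g = g * a" if "g \<in> G" for g
    using a assms[OF _ that] assms[OF that] unfolding bicommutant_def by force
  then show "a * b = b * a"
    using b unfolding bicommutant_def by auto
qed (auto simp: bicommutant_def distrib_left distrib_right scale_mult_left scale_mult_right)

lemma bicommutant_gen: "g \<in> G \<Longrightarrow> g \<in> bicommutant G"
  by (auto simp: bicommutant_def)

section \<open>The relations of the Hecke algebra\<close>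

lemma prod_list_intertwine:
  fixes f g :: "'b \<Rightarrow> 'a::monoid_mult"
  shows "(\<And>x. x \<in> set xs \<Longrightarrow> a * f x = g x * a) \<Longrightarrow> a * prod_list (map f xs) = prod_list (map g xs) * a"
proof (induction xs)
  case (Cons x xs)
  then have "a * f x = g x * a" "a * prod_list (map f xs) = prod_list (map g xs) * a" by auto
  then show ?case by simp (metis mult.assoc)
qed simp

lemma power_intertwine: "a * b = c * (a::'a::monoid_mult) \<Longrightarrow> a * b ^ k = c ^ k * a"
  using prod_list_intertwine[of "replicate k ()" a "\<lambda>_. b" "\<lambda>_. c"] by simp

lemma map_upto_shift: "map (\<lambda>i. g (i - 1)) [a..b] = map g [a - 1..b - 1]"
  by (rule nth_equalityI) (auto simp: nth_upto algebra_simps)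

context cyclotomic_hecke
begin

lemma proj_zero [simp]: "proj 0 = 0"
  using proj_add[of 0 0] by simp

lemma proj_diff: "proj (a - b) = proj a - proj b"
  using proj_add[of "a - b" b] by simp

lemma proj_one [simp]: "proj 1 = 1"
  using proj_const[of 1] by (simp add: free_const_def)

lemma proj_power: "proj (x ^ k) = proj x ^ k"
  by (induction k) (simp_all add: proj_mult)

lemma proj_prod_list: "proj (prod_list (map f xs)) = prod_list (map (\<lambda>x. proj (f x)) xs)"
  by (induction xs) (simp_all add: proj_mult)

lemmas proj_hom = proj_add proj_mult proj_diff proj_power proj_const

lemma proj_relator: "x \<in> hecke_relators q e \<Lambda> n \<Longrightarrow> proj x = 0"
  by (simp add: proj_eq_0_iff hull_inc)

lemma L_cyclotomic: "prod_list (map (\<lambda>i. (L 1 - (q powi i) *s 1) ^ \<Lambda> i) [0..int e - 1]) = 0"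
proof -
  have "proj (prod_list (map (\<lambda>i. (free_var (GenL 1) - free_const (q powi i)) ^ \<Lambda> i) [0..int e - 1])) = 0"
    by (rule proj_relator) (simp add: hecke_relators_def)
  then show ?thesis
    by (simp add: proj_prod_list proj_hom L_def)
qed

lemma L_outside: "r \<notin> {1..n} \<Longrightarrow> L r = 0"
  unfolding L_def by (rule proj_relator) (auto simp: hecke_relators_def)

lemma T_outside: "r \<notin> {1..<n} \<Longrightarrow> T r = 0"
  unfolding T_def by (rule proj_relator) (auto simp: hecke_relators_def)

lemma L_commute: "L r * L t = L t * L r"
proof (cases "r \<in> {1..n} \<and> t \<in> {1..n}")
  case True
  then have "proj (free_var (GenL r) * free_var (GenL t) - free_var (GenL t) * free_var (GenL r)) = 0"
    by (intro proj_relator) (unfold hecke_relators_def Let_def, blast)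
  then show ?thesis by (simp add: proj_hom L_def)
qed (auto simp: L_outside)

lemma T_quadratic: "r \<in> {1..<n} \<Longrightarrow> T r * T r = (q - 1) *s T r + q *s 1"
proof -
  assume "r \<in> {1..<n}"
  then have "proj ((free_var (GenT r) + 1) * (free_var (GenT r) - free_const q)) = 0"
    by (intro proj_relator) (unfold hecke_relators_def Let_def, blast)
  then show ?thesis
    by (simp add: proj_hom T_def algebra_simps scale_mult_left scale_mult_right)
qed

lemma T_L: "r \<in> {1..<n} \<Longrightarrow> T r * L r = L (r + 1) * T r - (q - 1) *s L (r + 1)"
proof -
  assume "r \<in> {1..<n}"
  then have "proj (free_var (GenT r) * free_var (GenL r) -
      free_var (GenL (r + 1)) * (free_var (GenT r) - free_const q + 1)) = 0"
    by (intro proj_relator) (unfold hecke_relators_def Let_def, blast)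
  then show ?thesis
    by (simp add: proj_hom T_def L_def algebra_simps scale_mult_left scale_mult_right)
qed

lemma T_braid: "T r * T (r + 1) * T r = T (r + 1) * T r * T (r + 1)"
proof (cases "r \<in> {1..<n} \<and> r + 1 \<in> {1..<n}")
  case True
  then have "proj (free_var (GenT r) * free_var (GenT (r + 1)) * free_var (GenT r) -
      free_var (GenT (r + 1)) * free_var (GenT r) * free_var (GenT (r + 1))) = 0"
    by (intro proj_relator) (unfold hecke_relators_def Let_def, blast)
  then show ?thesis by (simp add: proj_hom T_def)
qed (auto simp: T_outside)

lemma T_L_commute: "t \<noteq> r \<Longrightarrow> t \<noteq> r + 1 \<Longrightarrow> T r * L t = L t * T r"
proof (cases "r \<in> {1..<n} \<and> t \<in> {1..n}")
  case True
  assume "t \<noteq> r" "t \<noteq> r + 1"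
  with True have "proj (free_var (GenT r) * free_var (GenL t) - free_var (GenL t) * free_var (GenT r)) = 0"
    by (intro proj_relator) (unfold hecke_relators_def Let_def, blast)
  then show ?thesis by (simp add: proj_hom T_def L_def)
qed (auto simp: T_outside L_outside)

lemma T_T_commute: "r + 1 < t \<or> t + 1 < r \<Longrightarrow> T r * T t = T t * T r"
proof (cases "r \<in> {1..<n} \<and> t \<in> {1..<n}")
  case True
  assume "r + 1 < t \<or> t + 1 < r"
  with True have "proj (free_var (GenT r) * free_var (GenT t) - free_var (GenT t) * free_var (GenT r)) = 0"
    by (intro proj_relator) (unfold hecke_relators_def Let_def, blast)
  then show ?thesis by (simp add: proj_hom T_def)
qed (auto simp: T_outside)

sublocale Lalg: commutative_subalgebra scale "bicommutant (range L)"
  by (rule bicommutant_subalgebra) (auto simp: L_commute)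

lemma L_mem [simp, intro]: "L r \<in> bicommutant (range L)"
  by (auto intro: bicommutant_gen)

end

locale hecke_at_root = cyclotomic_hecke scale proj q e \<Lambda> n
  for scale :: "'k::field \<Rightarrow> 'a::ring_1 \<Rightarrow> 'a" (infixr "*s" 75)
    and proj :: "(hecke_gen, 'k) free_algebra \<Rightarrow> 'a"
    and q :: 'k and e :: nat and \<Lambda> :: "int \<Rightarrow> nat" and n :: nat +
  assumes q_nonzero: "q \<noteq> 0" and q_neq_1: "q \<noteq> 1"
    and quantum: "quantum_char q = e" and e_pos: "0 < e"
begin

lemma q_power_eq_1_iff: "q ^ m = 1 \<longleftrightarrow> e dvd m"
proof -
  have ex: "\<exists>m>0. (\<Sum>k<m. q ^ k) = 0"
    using quantum e_pos by (auto simp: quantum_char_def split: if_splits)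
  then have e: "e = (LEAST m. 0 < m \<and> (\<Sum>k<m. q ^ k) = 0)"
    using quantum by (simp add: quantum_char_def)
  have sum: "(\<Sum>k<m. q ^ k) = 0 \<longleftrightarrow> q ^ m = 1" for m
    using geometric_sum[OF q_neq_1, of m] q_neq_1 by simp
  have qe: "q ^ e = 1"
    using LeastI_ex[OF ex] unfolding e[symmetric] by (simp add: sum)
  have "q ^ m = (q ^ e) ^ (m div e) * q ^ (m mod e)"
    by (simp flip: power_mult power_add)
  then have "q ^ m = q ^ (m mod e)"
    by (simp add: qe)
  moreover have "q ^ (m mod e) = 1 \<longleftrightarrow> m mod e = 0"
    using not_less_Least[of "m mod e" "\<lambda>m. 0 < m \<and> (\<Sum>k<m. q ^ k) = 0"] e_pos
    unfolding e[symmetric] by (auto simp: sum)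
  ultimately show ?thesis
    by (simp add: dvd_eq_mod_eq_0)
qed

lemma q_powi_eq_iff: "q powi i = q powi j \<longleftrightarrow> i mod int e = j mod int e"
proof -
  have *: "q powi k = 1 \<longleftrightarrow> int e dvd k" for k
  proof (cases "0 \<le> k")
    case True
    then show ?thesis
      using q_power_eq_1_iff[of "nat k"] by (simp add: power_int_def int_dvd_int_iff[symmetric])
  next
    case False
    then show ?thesis
      using q_power_eq_1_iff[of "nat (- k)"]
      by (simp add: power_int_def int_dvd_int_iff[symmetric] power_inverse)
  qed
  have "q powi i = q powi j \<longleftrightarrow> q powi (i - j) = 1"
    using q_nonzero by (simp add: power_int_diff)
  then show ?thesis
    by (simp add: * mod_eq_dvd_iff)
qed

lemma q_powi_mod: "q powi (i mod int e) = q powi i"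
  by (simp add: q_powi_eq_iff)

lemma inj_on_q_powi: "inj_on (\<lambda>i. q powi i) {0..<int e}"
  by (auto simp: inj_on_def q_powi_eq_iff)

lemma e_ge_2: "2 \<le> e"
  using q_power_eq_1_iff[of 1] q_neq_1 e_pos by (cases "e = 1") auto

text \<open>
  Obtained from the relation for \<open>T\<^sub>r L\<^sub>r\<close> by multiplying with \<open>T\<^sub>r\<close> on both sides, which is where
  \<open>q \<noteq> 0\<close> enters.
\<close>

lemma T_L_Suc: "r \<in> {1..<n} \<Longrightarrow> T r * L (r + 1) = L r * T r + (q - 1) *s L (r + 1)"
proof -
  assume r: "r \<in> {1..<n}"
  have "T r * (T r * L r) * T r = T r * (L (r + 1) * T r - (q - 1) *s L (r + 1)) * T r"
    by (simp only: T_L[OF r])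
  also have "\<dots> = T r * L (r + 1) * (T r * T r) - (q - 1) *s (T r * L (r + 1) * T r)"
    by (simp add: algebra_simps scale_mult_left scale_mult_right)
  also have "\<dots> = q *s (T r * L (r + 1))"
    by (simp add: T_quadratic[OF r] algebra_simps scale_mult_left scale_mult_right)
  finally have "q *s (T r * L (r + 1)) = (T r * T r) * L r * T r"
    by (simp add: mult.assoc)
  also have "\<dots> = (q - 1) *s ((T r * L r) * T r) + q *s (L r * T r)"
    by (simp add: T_quadratic[OF r] algebra_simps scale_mult_left scale_mult_right)
  also have "(T r * L r) * T r = L (r + 1) * (T r * T r) - (q - 1) *s (L (r + 1) * T r)"
    by (simp add: T_L[OF r] algebra_simps scale_mult_left scale_mult_right)
  also have "\<dots> = q *s L (r + 1)"
    by (simp add: T_quadratic[OF r] algebra_simps scale_mult_left scale_mult_right)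
  finally have "q *s (T r * L (r + 1)) = q *s (L r * T r + (q - 1) *s L (r + 1))"
    by (simp add: scale_right_distrib mult.commute)
  then show ?thesis
    using q_nonzero by simp
qed

lemma L_recursion: "r \<in> {1..<n} \<Longrightarrow> q *s L (r + 1) = T r * L r * T r"
  by (simp add: T_L T_quadratic algebra_simps scale_mult_left scale_mult_right)

section \<open>Weight idempotents\<close>

text \<open>
  The polynomial with the roots \<open>q\<^sup>i\<close>, \<open>i \<in> I\<close>. Nilpotency of its value at \<open>L\<^sub>r\<close> says that all generalized
  eigenvalues of \<open>L\<^sub>r\<close> are of this form.
\<close>

definition spectral :: "'a \<Rightarrow> 'a" where
  "spectral x = prod_list (map (\<lambda>i. x - (q powi i) *s 1) [0..int e - 1])"

lemma spectral_mem [simp, intro]: "x \<in> bicommutant (range L) \<Longrightarrow> spectral x \<in> bicommutant (range L)"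
  unfolding spectral_def by (intro Lalg.prod_list_mem) auto

text \<open>
  Multiplication by \<open>q\<close> permutes the roots cyclically, since \<open>q\<^sup>e = 1\<close>.
\<close>

lemma spectral_scale: "x \<in> bicommutant (range L) \<Longrightarrow> spectral (q *s x) = spectral x"
proof -
  assume x: "x \<in> bicommutant (range L)"
  let ?f = "\<lambda>i. x - (q powi i) *s 1"
  have eq: "q *s x - (q powi i) *s 1 = q *s ?f (i - 1)" for i
    using q_nonzero by (simp add: scale_right_diff_distrib power_int_diff)
  have "spectral (q *s x) = prod_list (map (\<lambda>i. q *s ?f (i - 1)) [0..int e - 1])"
    by (simp only: spectral_def eq)
  also have "\<dots> = q ^ length [0..int e - 1] *s prod_list (map (\<lambda>i. ?f (i - 1)) [0..int e - 1])"
    by (rule prod_list_scale)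
  also have "\<dots> = prod_list (map ?f [-1..int e - 2])"
    using q_power_eq_1_iff[of e] map_upto_shift[of ?f 0 "int e - 1"] by simp
  also have "\<dots> = ?f (-1) * prod_list (map ?f [0..int e - 2])"
    using e_ge_2 by (simp add: upto_rec1)
  also have "?f (-1) = ?f (int e - 1)"
    using q_powi_eq_iff[of "-1" "int e - 1"] by (simp add: mod_eq_dvd_iff)
  also have "?f (int e - 1) * prod_list (map ?f [0..int e - 2]) = prod_list (map ?f [0..int e - 2]) * ?f (int e - 1)"
    using x by (intro Lalg.commute Lalg.prod_list_mem) auto
  also have "\<dots> = spectral x"
    using e_ge_2 by (simp add: spectral_def upto_rec2 mult.assoc)
  finally show ?thesis .
qed

text \<open>
  The intertwiner exchanges \<open>L\<^sub>r\<close> and \<open>L\<^sub>r\<^sub>+\<^sub>1\<close>, so an identity for \<open>L\<^sub>r\<close> becomes one for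
  \<open>L\<^sub>r\<^sub>+\<^sub>1\<close> up to the factor \<open>\<phi>\<^sup>2\<close>, which vanishes only where the quotient of the eigenvalues is
  \<open>q\<close> or \<open>q\<^sup>-\<^sup>1\<close>.
\<close>

lemma intertwiner:
  assumes r: "r \<in> {1..<n}"
  defines "\<phi> \<equiv> T r * L r - L r * T r"
  shows "\<phi> * L r = L (r + 1) * \<phi>"
    and "\<phi> * L (r + 1) = L r * \<phi>"
    and "\<phi> * \<phi> = (q *s L (r + 1) - L r) * (q *s L r - L (r + 1))"
proof -
  define A where "A = L r"
  define B where "B = L (r + 1)"
  define t where "t = T r"
  note eqs = T_L[OF r, folded A_def B_def t_def] T_L_Suc[OF r, folded A_def B_def t_def]
    T_quadratic[OF r, folded t_def]
  have assoc: "t * (A * c) = B * (t * c) - (q - 1) *s (B * c)"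
    "t * (B * c) = A * (t * c) + (q - 1) *s (B * c)"
    "t * (t * c) = (q - 1) *s (t * c) + q *s c" for c
    using eqs[THEN arg_cong, of "\<lambda>x. x * c"]
    by (simp_all add: mult.assoc scale_mult_left left_diff_distrib distrib_right)
  have AB: "B * A = A * B" "B * (A * c) = A * (B * c)" for c
    unfolding A_def B_def by (rule L_commute) (metis L_commute mult.assoc)
  note rules = assoc eqs AB scale_mult_left scale_mult_right algebra_simps
  show "\<phi> * L r = L (r + 1) * \<phi>" "\<phi> * L (r + 1) = L r * \<phi>"
    unfolding \<phi>_def A_def[symmetric] B_def[symmetric] t_def[symmetric] by (simp_all add: rules)
  show "\<phi> * \<phi> = (q *s L (r + 1) - L r) * (q *s L r - L (r + 1))"
    unfolding \<phi>_def A_def[symmetric] B_def[symmetric] t_def[symmetric] by (simp add: rules)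
qed

text \<open>
  Write \<open>p\<close> for the spectral polynomial. The intertwiner gives \<open>p(L\<^sub>r\<^sub>+\<^sub>1)\<^sup>N \<phi>\<^sup>2 = 0\<close>. Both factors of
  \<open>\<phi>\<^sup>2\<close> divide \<open>p(L\<^sub>r) - p(L\<^sub>r\<^sub>+\<^sub>1)\<close>, because \<open>p\<close> is invariant under scaling its argument by \<open>q\<close>.
  Hence \<open>p(L\<^sub>r\<^sub>+\<^sub>1)\<^sup>N (p(L\<^sub>r) - p(L\<^sub>r\<^sub>+\<^sub>1))\<^sup>2 = 0\<close>, and since \<open>p(L\<^sub>r)\<close> is nilpotent, so is
  \<open>p(L\<^sub>r\<^sub>+\<^sub>1)\<close>.
\<close>

lemma spectral_nilpotent_step:
  assumes r: "r \<in> {1..<n}" and nil: "spectral (L r) ^ N = 0"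
  shows "\<exists>M. spectral (L (r + 1)) ^ M = 0"
proof -
  let ?C = "bicommutant (range L)"
  let ?A = "L r" and ?B = "L (r + 1)"
  define \<phi> where "\<phi> = T r * ?A - ?A * T r"
  note \<phi> = intertwiner[OF r, folded \<phi>_def]
  define D where "D = spectral ?B"
  define E where "E = spectral ?A"
  have mem [simp]: "D \<in> ?C" "E \<in> ?C"
    by (auto simp: D_def E_def)
  have "\<phi> * E = D * \<phi>"
    unfolding D_def E_def spectral_def
    by (intro prod_list_intertwine) (simp add: \<phi>(1) algebra_simps scale_mult_left scale_mult_right)
  then have "\<phi> * E ^ N = D ^ N * \<phi>"
    by (rule power_intertwine)
  then have "D ^ N * (\<phi> * \<phi>) = 0"
    using nil by (simp add: E_def flip: mult.assoc)
  then have 0: "D ^ N * ((q *s ?B - ?A) * (q *s ?A - ?B)) = 0"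
    by (simp only: \<phi>(3))
  obtain g where g: "g \<in> ?C" "E - D = (q *s ?A - ?B) * g"
    using Lalg.prod_linear_diff_dvd[of "q *s ?A" ?B "\<lambda>i. q powi i" "[0..int e - 1]"]
    by (auto simp: D_def E_def spectral_scale simp flip: spectral_def)
  obtain h where h: "h \<in> ?C" "D - E = (q *s ?B - ?A) * h"
    using Lalg.prod_linear_diff_dvd[of "q *s ?B" ?A "\<lambda>i. q powi i" "[0..int e - 1]"]
    by (auto simp: D_def E_def spectral_scale simp flip: spectral_def)
  have "h * ((q *s ?A - ?B) * g) = (q *s ?A - ?B) * (h * g)"
    using g(1) h(1) by (intro Lalg.left_commute) auto
  then have "D ^ N * ((D - E) * (E - D)) = D ^ N * ((q *s ?B - ?A) * (q *s ?A - ?B)) * (h * g)"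
    unfolding g(2) h(2) by (simp only: mult.assoc)
  also have "\<dots> = 0" by (simp only: 0 mult_zero_left)
  \<comment> \<open>Expanding the square isolates a power of \<open>D\<close> that is a multiple of the nilpotent \<open>E\<close>.\<close>
  finally have "D ^ N * (D * D) = E * (D ^ N * (D + D - E))"
    by (simp add: algebra_simps Lalg.ac)
  then have "D ^ (N + 2) = E * (D ^ N * (D + D - E))"
    by (simp only: power_add power2_eq_square)
  then have "D ^ ((N + 2) * N) = 0"
    by (rule Lalg.nilpotent_mult) (use nil in \<open>auto simp: E_def[symmetric]\<close>)
  then show ?thesis
    unfolding D_def by blast
qed

lemma spectral_nilpotent: "r \<in> {1..n} \<Longrightarrow> \<exists>N. spectral (L r) ^ N = 0"
proof (induction r)
  case (Suc r)
  show ?case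
  proof (cases "r = 0")
    case True
    let ?f = "\<lambda>i. L 1 - (q powi i) *s 1"
    define N where "N = (\<Sum>i\<in>{0..<int e}. \<Lambda> i)"
    have "\<Lambda> i \<le> N" if "i \<in> {0..<int e}" for i
      unfolding N_def using that by (intro member_le_sum) auto
    then have "spectral (L 1) ^ N = prod_list (map (\<lambda>i. ?f i ^ \<Lambda> i * ?f i ^ (N - \<Lambda> i)) [0..int e - 1])"
      unfolding spectral_def by (subst Lalg.prod_list_power) (auto intro!: arg_cong[of _ _ prod_list] simp flip: power_add)
    also have "\<dots> = 0"
      using L_cyclotomic by (subst Lalg.prod_list_mult) auto
    finally show ?thesis using True by auto
  next
    case False
    then show ?thesis
      using Suc spectral_nilpotent_step[of r] by auto
  qed
qed simp

text \<open>
  Multiply the decompositions of \<open>1\<close> for \<open>L\<^sub>1, \<dots>, L\<^sub>m\<close>.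
\<close>

lemma weight_decomposition:
  "m \<le> n \<Longrightarrow> \<exists>F. (\<forall>i\<in>residue_seqs e m. F i \<in> bicommutant (range L) \<and>
      (\<forall>r\<in>{1..m}. \<exists>N. F i * (L r - (q powi i r) *s 1) ^ N = 0)) \<and> (\<Sum>i\<in>residue_seqs e m. F i) = 1"
proof (induction m)
  case 0
  show ?case by (auto simp: residue_seqs_def intro!: exI[of _ "\<lambda>_. 1"])
next
  case (Suc m)
  let ?C = "bicommutant (range L)"
  obtain F where F: "\<And>i. i \<in> residue_seqs e m \<Longrightarrow> F i \<in> ?C"
    "\<And>i r. i \<in> residue_seqs e m \<Longrightarrow> r \<in> {1..m} \<Longrightarrow> \<exists>N. F i * (L r - (q powi i r) *s 1) ^ N = 0"
    "(\<Sum>i\<in>residue_seqs e m. F i) = 1"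
    using Suc.IH[OF Suc_leD[OF Suc.prems]] by blast
  let ?X = "L (Suc m)"
  obtain N where "spectral ?X ^ N = 0"
    using spectral_nilpotent[of "Suc m"] Suc.prems by auto
  then have "1 * prod_list (map (\<lambda>i. (?X - (q powi i) *s 1) ^ N) [0..int e - 1]) = 0"
    by (simp add: spectral_def Lalg.prod_list_power)
  moreover have "set [0..int e - 1] = {0..<int e}" by auto
  ultimately have "\<exists>f. (\<forall>a\<in>{0..<int e}. f a \<in> ?C \<and> f a * (?X - (q powi a) *s 1) ^ N = 0) \<and>
      (\<Sum>a\<in>{0..<int e}. f a) = 1"
    using Lalg.generalized_eigenspace_decomposition[of ?X "\<lambda>i. q powi i" "[0..int e - 1]" 1 N] inj_on_q_powi
    by (simp del: set_upto)
  then obtain f where f: "\<And>a. a \<in> {0..<int e} \<Longrightarrow> f a \<in> ?C"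
    "\<And>a. a \<in> {0..<int e} \<Longrightarrow> f a * (?X - (q powi a) *s 1) ^ N = 0" "(\<Sum>a\<in>{0..<int e}. f a) = 1"
    by blast
  define G where "G i = F (restrict i {1..m}) * f (i (Suc m))" for i
  have ins: "{1..Suc m} = insert (Suc m) {1..m}" by auto
  have seqs: "residue_seqs e (Suc m) = (\<lambda>(a, i). i(Suc m := a)) ` ({0..<int e} \<times> residue_seqs e m)"
    unfolding residue_seqs_def ins by (rule PiE_insert_eq)
  have G: "G (i(Suc m := a)) = F i * f a" if "i \<in> residue_seqs e m" for i a
  proof -
    have "restrict (i(Suc m := a)) {1..m} = i"
      using that by (auto simp: residue_seqs_def fun_eq_iff PiE_def extensional_def)
    then show ?thesis by (simp add: G_def)
  qed
  have "(\<Sum>i\<in>residue_seqs e (Suc m). G i) = (\<Sum>(a, i)\<in>{0..<int e} \<times> residue_seqs e m. F i * f a)"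
    unfolding seqs using inj_combinator[of "Suc m" "{1..m}" "\<lambda>_. {0..<int e}"]
    by (subst sum.reindex) (auto simp: residue_seqs_def G[unfolded residue_seqs_def] intro!: sum.cong)
  also have "\<dots> = (\<Sum>i\<in>residue_seqs e m. F i) * (\<Sum>a\<in>{0..<int e}. f a)"
    by (subst sum.cartesian_product[symmetric], subst sum.swap) (simp add: sum_product)
  finally have "(\<Sum>i\<in>residue_seqs e (Suc m). G i) = 1"
    by (simp add: F f)
  moreover have "G j \<in> ?C \<and> (\<forall>r\<in>{1..Suc m}. \<exists>N. G j * (L r - (q powi j r) *s 1) ^ N = 0)"
    if jm: "j \<in> residue_seqs e (Suc m)" for j
  proof -
    obtain a i where ai: "a \<in> {0..<int e}" "i \<in> residue_seqs e m" "j = i(Suc m := a)"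
      using jm unfolding seqs by fastforce
    have Gj: "G j = F i * f a" using G ai by simp
    have "\<exists>N. G j * (L r - (q powi j r) *s 1) ^ N = 0" if r: "r \<in> {1..Suc m}" for r
    proof (cases "r = Suc m")
      case True
      then have "G j * (L r - (q powi j r) *s 1) ^ N = 0"
        unfolding Gj using f(2)[OF ai(1)] by (simp add: ai(3) mult.assoc)
      then show ?thesis by blast
    next
      case False
      then obtain M where "F i * (L r - (q powi i r) *s 1) ^ M = 0"
        using F(2)[OF ai(2), of r] r by auto
      then have "f a * (F i * (L r - (q powi i r) *s 1) ^ M) = 0" by simp
      then have "G j * (L r - (q powi j r) *s 1) ^ M = 0"
        unfolding Gj using False F(1)[OF ai(2)] f(1)[OF ai(1)] by (simp add: ai(3) Lalg.ac)
      then show ?thesis by blast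
    qed
    then show ?thesis using F(1) f(1) ai Gj by auto
  qed
  ultimately show ?case by blast
qed

lemma weight_space_mult_left: "h \<in> weight_space i \<Longrightarrow> a * h \<in> weight_space i"
  unfolding weight_space_def mem_Collect_eq by (metis mult.assoc mult_zero_right)

lemma weight_space_orthogonal:
  assumes "i \<in> residue_seqs e n" "j \<in> residue_seqs e n" "i \<noteq> j"
    and "h \<in> weight_space j" "x \<in> weight_space i" "x \<in> bicommutant (range L)"
  shows "h * x = 0"
proof -
  obtain r where r: "r \<in> {1..n}" "i r \<noteq> j r"
    using PiE_ext[OF assms(1,2)[unfolded residue_seqs_def]] assms(3) by blast
  obtain N M where N: "x * (L r - (q powi i r) *s 1) ^ N = 0"
    and M: "h * (L r - (q powi j r) *s 1) ^ M = 0"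
    using assms(4,5) r(1) unfolding weight_space_def by blast
  have "h * x * (L r - (q powi j r) *s 1) ^ M = h * (L r - (q powi j r) *s 1) ^ M * x"
    using assms(6) Lalg.commute[of x "(L r - (q powi j r) *s 1) ^ M"] by (simp add: mult.assoc)
  moreover have "q powi i r \<noteq> q powi j r"
    using assms(1,2) r inj_onD[OF inj_on_q_powi, of "i r" "j r"] by (auto simp: residue_seqs_def PiE_def Pi_def)
  ultimately show ?thesis
    using Lalg.generalized_eigenspaces_disjoint[of "L r" "q powi i r" "q powi j r" "h * x" N M] N M
    by (simp add: mult.assoc)
qed

text \<open>
  The description of \<open>e(i)\<close> as a projection determines it: any element with these properties equals the
  summand \<open>F i\<close> of the decomposition of \<open>1\<close>, as one sees on multiplying that decomposition by it. So
  \<open>e(i)\<close> lies in the commutative subalgebra, and in particular it commutes with the \<open>L\<^sub>r\<close>.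
\<close>

lemma idem_exists:
  assumes i: "i \<in> residue_seqs e n"
  shows "idem i \<in> bicommutant (range L) \<and> idem i \<in> weight_space i \<and> (\<forall>h\<in>weight_space i. h * idem i = h)"
proof -
  let ?R = "residue_seqs e n"
  obtain F where F: "\<And>j. j \<in> ?R \<Longrightarrow> F j \<in> bicommutant (range L)"
    "\<And>j. j \<in> ?R \<Longrightarrow> F j \<in> weight_space j" "(\<Sum>j\<in>?R. F j) = 1"
    using weight_decomposition[of n] by (auto simp: weight_space_def)
  have fin: "finite ?R" by (auto simp: residue_seqs_def intro!: finite_PiE)
  have proj_on: "h * F i = h" if "h \<in> weight_space i" for h
  proof -
    have "h = (\<Sum>j\<in>?R. h * F j)" by (simp add: F(3) flip: sum_distrib_left)
    also have "\<dots> = (\<Sum>j\<in>?R. if j = i then h * F i else 0)"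
      using weight_space_orthogonal[of _ i h] that F i by (intro sum.cong) auto
    finally show ?thesis using i fin by simp
  qed
  have "idem i = F i"
    unfolding idem_def
  proof (rule the_equality)
    show "F i * F i = F i \<and> (\<forall>h. h * F i \<in> weight_space i) \<and> (\<forall>h\<in>weight_space i. h * F i = h) \<and>
        (\<forall>j\<in>?R - {i}. \<forall>h\<in>weight_space j. h * F i = 0)"
      using proj_on F i weight_space_mult_left weight_space_orthogonal by auto
  next
    fix x assume x: "x * x = x \<and> (\<forall>h. h * x \<in> weight_space i) \<and> (\<forall>h\<in>weight_space i. h * x = h) \<and>
        (\<forall>j\<in>?R - {i}. \<forall>h\<in>weight_space j. h * x = 0)"
    have "x = (\<Sum>j\<in>?R. F j * x)" by (simp add: F(3) flip: sum_distrib_right)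
    also have "\<dots> = (\<Sum>j\<in>?R. if j = i then F i else 0)"
      using x F i by (intro sum.cong) auto
    finally show "x = F i" using i fin by simp
  qed
  then show ?thesis using F i proj_on by simp
qed

end

section \<open>The weighted sum of all standard basis elements\<close>

lemma (in field_algebra) sum_mult_scale_right: "a * (\<Sum>i\<in>I. c i *s b i) = (\<Sum>i\<in>I. c i *s (a * b i))"
  by (simp add: sum_distrib_left scale_mult_right)

context cyclotomic_hecke
begin

definition T_word :: "nat list \<Rightarrow> 'a" where
  "T_word ks = prod_list (map T ks)"

lemma T_word_simps [simp]: "T_word [] = 1" "T_word (k # ks) = T k * T_word ks"
    "T_word (ks @ ks') = T_word ks * T_word ks'"
  by (simp_all add: T_word_def)

lemma T_word_cong: "ks \<approx> ks' \<Longrightarrow> T_word ks = T_word ks'"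
proof (induction rule: braid_equiv.induct)
  case (comm r t xs ys)
  then have "T r * T t = T t * T r" by (intro T_T_commute) auto
  from arg_cong[OF this, of "\<lambda>x. T_word xs * (x * T_word ys)"] show ?case
    by (simp add: mult.assoc)
next
  case (braid xs r ys)
  show ?case
    using arg_cong[OF T_braid[of r], of "\<lambda>x. T_word xs * (x * T_word ys)"] by (simp add: mult.assoc)
qed auto

lemma T_perm_normal: "v \<in> normal_words n \<Longrightarrow> T_perm (simple_word_perm v) = T_word v"
  unfolding T_perm_def T_word_def[symmetric]
  by (rule T_word_cong, rule reduced_word_normal(2)) (auto intro: someI reduced_word_normal(3))

text \<open>
  Summing over normal words rather than permutations makes the coset factorization of \<open>S\<^sub>m\<^sub>+\<^sub>1\<close>
  definitional. The values \<open>t = 1\<close> and \<open>t = - q\<^sup>-\<^sup>1\<close> give the two sums \<open>x\<close> and \<open>x'\<close>.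
\<close>

definition poincare :: "'k \<Rightarrow> nat \<Rightarrow> 'a" where
  "poincare t m = (\<Sum>v\<in>normal_words m. (t ^ length v) *s T_word v)"

lemma sum_permutes_eq_poincare:
  "(\<Sum>w | w permutes {1..n}. (t ^ perm_length n w) *s T_perm w) = poincare t n"
  unfolding poincare_def
  by (subst sum.reindex_bij_betw[OF normal_words_bij(2), symmetric])
     (auto intro!: sum.cong simp: reduced_word_normal(1) T_perm_normal)

lemma poincare_Suc:
  "poincare t (Suc m) = poincare t m * (\<Sum>k\<in>{1..Suc m}. (t ^ (Suc m - k)) *s T_word (descending m k))"
proof -
  have "poincare t (Suc m) =
      (\<Sum>(v, k)\<in>normal_words m \<times> {1..Suc m}. (t ^ length v *s T_word v) * ((t ^ (Suc m - k)) *s T_word (descending m k)))"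
    unfolding poincare_def
    by (subst sum.reindex_bij_betw[OF normal_words_bij(1), symmetric])
       (auto intro!: sum.cong simp: scale_mult_left scale_mult_right mult.commute simp flip: power_add)
  then show ?thesis
    by (simp only: poincare_def[of t m] sum_product sum.cartesian_product)
qed

lemma poincare_commutes:
  assumes "\<And>r. r \<in> {1..<m} \<Longrightarrow> T r * b = b * T r"
  shows "poincare t m * b = b * poincare t m"
proof -
  have "b * T_word v = T_word v * b" if "v \<in> normal_words m" for v
    unfolding T_word_def using normal_words_letters[OF that] assms
    by (intro prod_list_intertwine) auto
  then show ?thesis
    by (simp add: poincare_def sum_distrib_left sum_distrib_right scale_mult_left scale_mult_right)
qed

text \<open>
  In the coset factorization, \<open>T\<^sub>r\<close> passes through all but two of the descending words and is absorbed
  by the induction hypothesis. The two words that begin at \<open>m\<close> and end at \<open>r\<close> and \<open>r + 1\<close> are exchanged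
  up to the quadratic relation, and their weighted sum is an eigenvector because
  \<open>t (q - 1) + 1 = t\<^sup>2 q\<close>, that is, \<open>(t q + 1) (t - 1) = 0\<close>.
\<close>

lemma poincare_eigenvector:
  assumes t: "(t * q + 1) * (t - 1) = 0"
  shows "m \<le> n \<Longrightarrow> r \<in> {1..<m} \<Longrightarrow> poincare t m * T r = (t * q) *s poincare t m"
proof (induction m arbitrary: r)
  case (Suc m)
  have r: "1 \<le> r" "r \<le> m" using Suc.prems by auto
  let ?D = "\<lambda>k. T_word (descending m k)"
  define F where "F k = poincare t m * ((t ^ (Suc m - k)) *s ?D k)" for k
  define G where "G k = F k * T r - (t * q) *s F k" for k
  have G0: "G k = 0" if r': "r' \<in> {1..<m}" and eq: "descending m k @ [r] \<approx> r' # descending m k" for k r'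
  proof -
    have D: "?D k * T r = T r' * ?D k" using T_word_cong[OF eq] by simp
    have "F k * T r = (t ^ (Suc m - k)) *s (poincare t m * (?D k * T r))"
      by (simp add: F_def scale_mult_left scale_mult_right mult.assoc)
    also have "\<dots> = (t ^ (Suc m - k)) *s ((poincare t m * T r') * ?D k)"
      by (simp only: D mult.assoc)
    also have "\<dots> = (t * q) *s F k"
      using Suc r' by (simp add: F_def scale_mult_left scale_mult_right mult.commute)
    finally show ?thesis by (simp add: G_def)
  qed
  have G_low: "G k = 0" if "k \<in> {1..Suc m}" "k < r" for k
    using G0[of "r - 1" k] descending_braid[of k "r - 1" m] that r by (cases r) auto
  have G_high: "G k = 0" if "k \<in> {1..Suc m}" "Suc r < k" for k
    using that r by (intro G0[of r k] braid_equiv_move) auto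
  define D where "D = ?D (Suc r)"
  have Dr: "?D r = D * T r"
    using descending_snoc[of r m] r by (simp add: D_def)
  have e: "t ^ (Suc m - r) = t * t ^ (m - r)"
    using r by (simp add: Suc_diff_le)
  have t2: "t * (q - 1) + 1 = t * q * t"
    using t by (simp add: algebra_simps)
  have DTT: "D * (T r * T r) = (q - 1) *s (D * T r) + q *s D"
    using r Suc.prems T_quadratic[of r] by (simp add: distrib_left scale_mult_right)
  have "(t * t ^ (m - r)) *s (D * (T r * T r)) + (t ^ (m - r)) *s (D * T r)
      = (t ^ (m - r) * (t * (q - 1) + 1)) *s (D * T r) + (t * t ^ (m - r) * q) *s D"
    unfolding DTT by (simp add: algebra_simps)
  also have "\<dots> = (t * q) *s ((t * t ^ (m - r)) *s (D * T r) + (t ^ (m - r)) *s D)"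
    unfolding t2 by (simp add: algebra_simps)
  finally have pair: "(t * t ^ (m - r)) *s (D * (T r * T r)) + (t ^ (m - r)) *s (D * T r)
      = (t * q) *s ((t * t ^ (m - r)) *s (D * T r) + (t ^ (m - r)) *s D)" .
  have "F r * T r + F (Suc r) * T r =
      poincare t m * ((t * t ^ (m - r)) *s (D * (T r * T r)) + (t ^ (m - r)) *s (D * T r))"
    by (simp add: F_def Dr e D_def[symmetric] scale_mult_left scale_mult_right distrib_left mult.assoc)
  also have "\<dots> = (t * q) *s F r + (t * q) *s F (Suc r)"
    unfolding pair
    by (simp add: F_def Dr e D_def[symmetric] scale_mult_right distrib_left scale_right_distrib)
  finally have "G r + G (Suc r) = 0"
    by (simp add: G_def algebra_simps)
  then have "(\<Sum>k\<in>{1..Suc m}. G k) = 0"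
    using r G_low G_high by (subst sum.mono_neutral_right[of _ "{r, Suc r}"]) (auto, force)
  then show ?case
    unfolding poincare_Suc
    by (simp add: G_def F_def sum_subtractf sum_distrib_left sum_distrib_right scale_sum_right del: sum.cl_ivl_Suc)
qed simp

end

section \<open>The eigenvector property and the recursion\<close>

lemma prod_list_one: "(\<And>x. x \<in> set xs \<Longrightarrow> f x = 1) \<Longrightarrow> prod_list (map f xs) = (1 :: 'a::monoid_mult)"
  by (induction xs) auto

lemma commute_mult: "c * a = a * c \<Longrightarrow> c * b = b * c \<Longrightarrow> c * (a * b) = a * b * (c :: 'a::monoid_mult)"
  by (metis mult.assoc)

text \<open>
  The parameter \<open>t\<close> treats the two signs uniformly: the eigenvalue of each \<open>T\<^sub>r\<close> on \<open>z\<close> is \<open>t q\<close>, and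
  \<open>t\<^sup>2 q = q\<^sup>\<epsilon>\<close> is the ratio of consecutive eigenvalues of the \<open>L\<^sub>k\<close>.
\<close>

locale hecke_sign = hecke_at_root scale proj q e \<Lambda> n
  for scale :: "'k::field \<Rightarrow> 'a::ring_1 \<Rightarrow> 'a" (infixr "*s" 75)
    and proj :: "(hecke_gen, 'k) free_algebra \<Rightarrow> 'a"
    and q :: 'k and e :: nat and \<Lambda> :: "int \<Rightarrow> nat" and n :: nat +
  fixes s \<epsilon> :: int and t :: 'k
  assumes sign: "\<epsilon> = 1 \<and> t = 1 \<or> \<epsilon> = -1 \<and> t = - inverse q"
    and weight_pos: "0 < \<Lambda> (s mod int e)"
begin

lemma t_root: "(t * q + 1) * (t - 1) = 0"
  using sign q_nonzero by auto

lemma t_square: "t * t * q = q powi \<epsilon>"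
  using sign q_nonzero by (auto simp: power_int_minus mult.assoc)

text \<open>
  The eigenvalue of \<open>L\<^sub>k\<close> on \<open>z\<close>.
\<close>

definition content :: "nat \<Rightarrow> 'k" where
  "content k = q powi (s + \<epsilon> * (int k - 1))"

lemma content_Suc: "content (Suc k) = q powi \<epsilon> * content k"
proof -
  have "s + \<epsilon> * (int (Suc k) - 1) = \<epsilon> + (s + \<epsilon> * (int k - 1))"
    by (simp add: algebra_simps)
  then show ?thesis
    unfolding content_def using q_nonzero by (simp only: power_int_add simp_thms)
qed

lemma content_nonzero: "content k \<noteq> 0"
  using q_nonzero by (simp add: content_def)

definition u_exponent :: "int \<Rightarrow> nat" where
  "u_exponent i = \<Lambda> i - of_bool (i = s mod int e)"

definition u_factor :: "'a \<Rightarrow> 'a" where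
  "u_factor x = prod_list (map (\<lambda>i. (x - (q powi i) *s 1) ^ u_exponent i) [0..int e - 1])"

text \<open>
  The analogue of \<open>u\<close> for the first \<open>m\<close> strands, formed inside the same algebra.
\<close>

definition u_part :: "nat \<Rightarrow> 'a" where
  "u_part m = prod_list (map (\<lambda>i. prod_list (map (\<lambda>k. L k - (q powi i) *s 1) [1..<m + 1]) ^ u_exponent i) [0..int e - 1])"

lemma u_part_n: "u_part n = u s"
  by (simp add: u_part_def u_def u_exponent_def)

lemma u_part_mem [simp, intro]: "u_part m \<in> bicommutant (range L)"
  unfolding u_part_def by (intro Lalg.prod_list_mem Lalg.power_mem) auto

lemma u_factor_mem [simp, intro]: "x \<in> bicommutant (range L) \<Longrightarrow> u_factor x \<in> bicommutant (range L)"
  unfolding u_factor_def by (intro Lalg.prod_list_mem Lalg.power_mem) auto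

lemma u_part_Suc: "u_part (Suc m) = u_part m * u_factor (L (Suc m))"
proof -
  have "prod_list (map (\<lambda>k. L k - c *s 1) [1..<m + 1]) \<in> bicommutant (range L)" for c
    by (intro Lalg.prod_list_mem) auto
  then show ?thesis
    unfolding u_part_def u_factor_def
    by (subst Lalg.prod_list_mult[symmetric]) (auto simp: Lalg.power_mult)
qed

lemma u_part_0: "u_part 0 = 1"
  unfolding u_part_def by (intro prod_list_one) simp

text \<open>
  Since \<open>\<Lambda> s > 0\<close>, multiplying by \<open>L\<^sub>1 - q\<^sup>s\<close> restores the factor missing from the cyclotomic
  relation.
\<close>

lemma u_factor_kills: "u_factor (L 1) * (L 1 - (q powi s) *s 1) = 0"
proof -
  have "u_factor (L 1) * (L 1 - (q powi (s mod int e)) *s 1) =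
      prod_list (map (\<lambda>i. (L 1 - (q powi i) *s 1) ^ \<Lambda> i) [0..int e - 1])"
    unfolding u_factor_def u_exponent_def
    using e_ge_2 weight_pos by (intro Lalg.prod_list_raise) auto
  then show ?thesis
    using L_cyclotomic by (simp add: q_powi_mod)
qed

lemma u_part_L1: "1 \<le> m \<Longrightarrow> u_part m * (L 1 - (q powi s) *s 1) = 0"
proof (induction m rule: dec_induct)
  case base
  show ?case using u_part_Suc[of 0] u_factor_kills by (simp add: u_part_0)
next
  case (step m)
  have "u_part (Suc m) * (L 1 - (q powi s) *s 1) = u_part m * (L 1 - (q powi s) *s 1) * u_factor (L (Suc m))"
    unfolding u_part_Suc by (simp add: mult.assoc Lalg.commute[of "u_factor (L (Suc m))"])
  then show ?case by (simp only: step.IH mult_zero_left)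
qed

text \<open>
  Of the factors, only \<open>L\<^sub>r - c\<close> and \<open>L\<^sub>r\<^sub>+\<^sub>1 - c\<close> fail to commute with \<open>T\<^sub>r\<close>, and their product commutes
  with it.
\<close>

lemma T_commutes_symmetric:
  assumes r: "r \<in> {1..<m}"
  shows "T r * prod_list (map (\<lambda>k. L k - c *s 1) [1..<m + 1]) =
    prod_list (map (\<lambda>k. L k - c *s 1) [1..<m + 1]) * T r"
proof (cases "r < n")
  case True
  let ?f = "\<lambda>k. L k - c *s 1"
  have "[1..<m + 1] = [1..<r] @ [r..<m + 1]"
    using r upt_add_eq_append[of 1 r "m + 1 - r"] by simp
  moreover have "[r..<m + 1] = r # (r + 1) # [r + 2..<m + 1]"
    using r by (simp add: upt_rec[of r] upt_rec[of "Suc r"] del: upt_Suc)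
  ultimately have split: "prod_list (map ?f [1..<m + 1]) =
      prod_list (map ?f [1..<r]) * ((?f r * ?f (r + 1)) * prod_list (map ?f [r + 2..<m + 1]))"
    by (simp add: mult.assoc del: upt_Suc)
  have comm: "T r * ?f k = ?f k * T r" if "k \<noteq> r" "k \<noteq> r + 1" for k
    using T_L_commute[OF that] by (simp add: algebra_simps scale_mult_left scale_mult_right)
  have 1: "T r * prod_list (map ?f [1..<r]) = prod_list (map ?f [1..<r]) * T r"
    using comm by (intro prod_list_intertwine) auto
  have 2: "T r * prod_list (map ?f [r + 2..<m + 1]) = prod_list (map ?f [r + 2..<m + 1]) * T r"
    using comm by (intro prod_list_intertwine) auto
  have rn: "r \<in> {1..<n}" using r True by auto
  define A where "A = L r"
  define B where "B = L (r + 1)"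
  define t where "t = T r"
  note eqs = T_L[OF rn, folded A_def B_def t_def] T_L_Suc[OF rn, folded A_def B_def t_def]
  have tA: "t * (A * a) = B * (t * a) - (q - 1) *s (B * a)" for a
    using arg_cong[OF eqs(1), of "\<lambda>x. x * a"] by (simp add: mult.assoc scale_mult_left left_diff_distrib)
  have AB: "B * A = A * B" "B * (A * a) = A * (B * a)" for a
    unfolding A_def B_def by (rule L_commute) (metis L_commute mult.assoc)
  have 3: "T r * (?f r * ?f (r + 1)) = (?f r * ?f (r + 1)) * T r"
    unfolding A_def[symmetric] B_def[symmetric] t_def[symmetric]
    by (simp add: tA eqs AB algebra_simps scale_mult_left scale_mult_right)
  show ?thesis
    unfolding split by (intro commute_mult 1 2 3)
next
  case False
  then show ?thesis by (simp add: T_outside)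
qed

lemma T_commutes_u_part: "r \<in> {1..<m} \<Longrightarrow> T r * u_part m = u_part m * T r"
  unfolding u_part_def
  by (intro prod_list_intertwine power_intertwine T_commutes_symmetric)

definition z_part :: "nat \<Rightarrow> 'a" where
  "z_part m = u_part m * poincare t m"

lemma z_part_n: "z_part n = z \<epsilon> s"
proof -
  have "(- inverse q) ^ k = (- q) powi (- int k)" for k
    unfolding power_int_minus power_int_of_nat using power_inverse[of "- q" k] by simp
  then have "x_minus = poincare (- inverse q) n"
    unfolding x_minus_def sum_permutes_eq_poincare[symmetric] by simp
  moreover have "x_plus = poincare 1 n"
    unfolding x_plus_def sum_permutes_eq_poincare[symmetric] by simp
  ultimately show ?thesis
    using sign by (auto simp: z_part_def z_def u_part_n)
qed

lemma z_part_T: "m \<le> n \<Longrightarrow> r \<in> {1..<m} \<Longrightarrow> z_part m * T r = (t * q) *s z_part m"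
  by (simp add: z_part_def mult.assoc poincare_eigenvector[OF t_root] scale_mult_right)

text \<open>
  By \<open>q L\<^sub>k\<^sub>+\<^sub>1 = T\<^sub>k L\<^sub>k T\<^sub>k\<close>, passing from \<open>k\<close> to \<open>k + 1\<close> multiplies the eigenvalue by
  \<open>(t q)\<^sup>2 / q = q\<^sup>\<epsilon>\<close>.
\<close>

lemma z_part_L:
  assumes "m \<le> n"
  shows "1 \<le> k \<Longrightarrow> k \<le> m \<Longrightarrow> z_part m * L k = content k *s z_part m"
proof (induction k rule: dec_induct)
  case base
  have "poincare t m * u_part m = u_part m * poincare t m"
    by (intro poincare_commutes T_commutes_u_part)
  then have "z_part m * (L 1 - (q powi s) *s 1) = poincare t m * (u_part m * (L 1 - (q powi s) *s 1))"
    by (simp add: z_part_def flip: mult.assoc)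
  also have "\<dots> = 0" using u_part_L1[of m] base by simp
  finally show ?case
    by (simp add: content_def algebra_simps scale_mult_right)
next
  case (step k)
  have k: "k \<in> {1..<m}" using step by auto
  have "q *s (z_part m * L (Suc k)) = z_part m * T k * L k * T k"
    using L_recursion[of k] k assms by (simp add: mult.assoc flip: scale_mult_right)
  also have "\<dots> = (t * q * content k * t * q) *s z_part m"
    using step k by (simp add: z_part_T[OF assms k] scale_mult_left mult.assoc mult.commute mult.left_commute)
  also have "\<dots> = q *s (content (Suc k) *s z_part m)"
    by (simp add: content_Suc t_square[symmetric] ac_simps)
  finally show ?case by (rule scale_left_imp_eq[OF q_nonzero])
qed

text \<open>
  Put \<open>v = z\<^sub>m f(L\<^sub>m\<^sub>+\<^sub>1)\<close>, where \<open>f\<close> is the cyclotomic factor, so that \<open>z\<^sub>m\<^sub>+\<^sub>1\<close> is the sum of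
  \<open>t\<^sup>m\<^sup>+\<^sup>1\<^sup>-\<^sup>k v T\<^sub>m \<dots> T\<^sub>k\<close>. Moving \<open>L\<^sub>m\<^sub>+\<^sub>1\<close> to the left past \<open>T\<^sub>m\<close> produces the eigenvalue of \<open>L\<^sub>m\<close> on \<open>v\<close>
  and an error term in which \<open>T\<^sub>m\<close> is gone, so that the remaining letters are absorbed by \<open>v\<close>. The
  errors add up to a geometric series. On the other side, \<open>L\<^sub>m\<^sub>+\<^sub>1\<close> acts on \<open>z\<^sub>m\<^sub>+\<^sub>1\<close> by its eigenvalue,
  which differs from that of \<open>L\<^sub>m\<close>; so the identity can be solved for \<open>z\<^sub>m\<^sub>+\<^sub>1\<close>.
\<close>

lemma z_part_step:
  assumes m: "1 \<le> m" "Suc m \<le> n"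
  defines "X \<equiv> L (Suc m)"
  shows "(content (Suc m) - content m) *s z_part (Suc m) =
    (q powi (\<epsilon> * int m)) *s (z_part m * u_factor X * (X - (q powi (s - \<epsilon>)) *s 1))"
proof -
  define v where "v = z_part m * u_factor X"
  let ?D = "\<lambda>m k. T_word (descending m k)"
  have TX: "T r * X = X * T r" if "r \<in> {1..<m}" for r
    unfolding X_def using that by (intro T_L_commute) auto
  have TF: "T r * u_factor X = u_factor X * T r" if "r \<in> {1..<m}" for r
    unfolding u_factor_def using TX[OF that]
    by (intro prod_list_intertwine power_intertwine) (simp add: algebra_simps scale_mult_left scale_mult_right)
  have vT: "v * T r = (t * q) *s v" if "r \<in> {1..<m}" for r
  proof -
    have "v * T r = z_part m * T r * u_factor X"
      using TF[OF that] by (simp add: v_def mult.assoc)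
    then show ?thesis
      using z_part_T[of m r] m that by (simp add: v_def scale_mult_left)
  qed
  have vword: "v * T_word ks = ((t * q) ^ length ks) *s v" if "set ks \<subseteq> {1..<m}" for ks
    using that by (induction ks) (simp_all add: vT scale_mult_left mult.commute flip: mult.assoc)
  have vL: "v * L m = content m *s v"
  proof -
    have "v * L m = z_part m * L m * u_factor X"
      by (simp add: v_def X_def mult.assoc Lalg.commute[of "L m"])
    then show ?thesis
      using z_part_L[of m m] m by (simp add: v_def scale_mult_left)
  qed
  have z: "z_part (Suc m) = (\<Sum>k\<in>{1..Suc m}. (t ^ (Suc m - k)) *s (v * ?D m k))"
  proof -
    have "poincare t m * u_factor X = u_factor X * poincare t m"
      by (intro poincare_commutes TF)
    then have "u_factor X * (poincare t m * b) = poincare t m * (u_factor X * b)" for b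
      by (metis mult.assoc)
    then have "z_part (Suc m) = v * (\<Sum>k\<in>{1..Suc m}. (t ^ (Suc m - k)) *s ?D m k)"
      unfolding z_part_def u_part_Suc poincare_Suc v_def X_def[symmetric] by (simp only: mult.assoc)
    then show ?thesis by (simp only: sum_mult_scale_right)
  qed
  have low: "(v * ?D m k) * X - content m *s (v * ?D m k) = ((q - 1) * (t * q) ^ (m - k)) *s (v * X)"
    if k: "k \<in> {1..m}" for k
  proof -
    obtain m' where m': "m = Suc m'" using m by (cases m) auto
    have D: "?D m k = T m * ?D m' k"
      using k by (simp add: m' descending_Suc)
    have DX: "?D m' k * X = X * ?D m' k"
      unfolding T_word_def using TX k m'
      by (intro prod_list_intertwine[symmetric]) auto
    have "(v * ?D m k) * X = v * (T m * X) * ?D m' k"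
      by (simp add: D DX mult.assoc)
    also have "T m * X = L m * T m + (q - 1) *s X"
      using T_L_Suc[of m] m by (simp add: X_def)
    also have "v * (L m * T m + (q - 1) *s X) * ?D m' k =
        (v * L m) * ?D m k + (q - 1) *s (v * ?D m' k * X)"
      by (simp add: D DX distrib_left distrib_right scale_mult_left scale_mult_right mult.assoc)
    also have "v * ?D m' k = ((t * q) ^ (m - k)) *s v"
      using k m' by (subst vword) auto
    finally show ?thesis
      by (simp add: vL scale_mult_left)
  qed
  \<comment> \<open>The summand for \<open>k = m + 1\<close> is \<open>v\<close> itself and contributes no error term.\<close>
  have "z_part (Suc m) * X - content m *s z_part (Suc m) =
      (\<Sum>k\<in>{1..Suc m}. (t ^ (Suc m - k)) *s ((v * ?D m k) * X - content m *s (v * ?D m k)))"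
    unfolding z by (simp add: sum_distrib_right scale_sum_right scale_mult_left sum_subtractf
        scale_right_diff_distrib mult.commute del: sum.cl_ivl_Suc)
  also have "\<dots> = (\<Sum>k\<in>{1..m}. (t ^ (Suc m - k)) *s (((q - 1) * (t * q) ^ (m - k)) *s (v * X))) +
      (v * X - content m *s v)"
    by (simp add: low)
  also have "(\<Sum>k\<in>{1..m}. (t ^ (Suc m - k)) *s (((q - 1) * (t * q) ^ (m - k)) *s (v * X))) =
      (\<Sum>k\<in>{1..m}. t ^ (Suc m - k) * ((q - 1) * (t * q) ^ (m - k))) *s (v * X)"
    by (simp add: scale_sum_left)
  also have "(\<Sum>k\<in>{1..m}. t ^ (Suc m - k) * ((q - 1) * (t * q) ^ (m - k))) =
      (\<Sum>k\<in>{1..m}. (q powi \<epsilon> - 1) * (q powi \<epsilon>) ^ (m - k))"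
  proof (rule sum.cong)
    fix k assume "k \<in> {1..m}"
    then have "t ^ (Suc m - k) * ((q - 1) * (t * q) ^ (m - k)) = (t * (q - 1)) * (t * t * q) ^ (m - k)"
      by (simp add: Suc_diff_le power_mult_distrib ac_simps)
    also have "t * (q - 1) = q powi \<epsilon> - 1"
      using t_root by (simp add: t_square[symmetric] algebra_simps)
    finally show "t ^ (Suc m - k) * ((q - 1) * (t * q) ^ (m - k)) = (q powi \<epsilon> - 1) * (q powi \<epsilon>) ^ (m - k)"
      by (simp add: t_square)
  qed simp
  also have "\<dots> = (q powi \<epsilon> - 1) * (\<Sum>j<m. (q powi \<epsilon>) ^ j)"
    unfolding sum_distrib_left
    by (rule sum.reindex_bij_witness[of _ "\<lambda>j. m - j" "\<lambda>k. m - k"]) auto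
  also have "\<dots> = (q powi \<epsilon>) ^ m - 1"
    by (simp add: power_diff_1_eq)
  also have "(q powi \<epsilon>) ^ m = q powi (\<epsilon> * int m)"
    by (simp add: power_int_mult)
  also have "(q powi (\<epsilon> * int m) - 1) *s (v * X) + (v * X - content m *s v) =
      (q powi (\<epsilon> * int m)) *s (v * (X - (q powi (s - \<epsilon>)) *s 1))"
    using q_nonzero
    by (simp add: content_def algebra_simps scale_mult_right flip: power_int_add)
  finally show ?thesis
    using z_part_L[of "Suc m" "Suc m"] m
    by (simp add: X_def v_def scale_left_diff_distrib)
qed

end

section \<open>Linear factors and their values on the weight space\<close>

lemma prod_list_filter_eq:
  "prod_list (map f (filter (\<lambda>x. x = c) xs)) = (f c :: 'a::monoid_mult) ^ count_list xs c"
  by (induction xs) auto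

lemma count_list_concat_replicate:
  "distinct xs \<Longrightarrow> count_list (concat (map (\<lambda>i. replicate (\<mu> i) i) xs)) c = (if c \<in> set xs then \<mu> c else 0)"
proof -
  have "count_list (replicate k i) c = (if c = i then k else 0)" for k i
    by (induction k) auto
  then show "distinct xs \<Longrightarrow> count_list (concat (map (\<lambda>i. replicate (\<mu> i) i) xs)) c = (if c \<in> set xs then \<mu> c else 0)"
    by (induction xs) auto
qed

lemma prod_list_concat_replicate:
  "prod_list (map f (concat (map (\<lambda>i. replicate (\<mu> i) i) xs))) = prod_list (map (\<lambda>i. (f i :: 'a::monoid_mult) ^ \<mu> i) xs)"
  by (induction xs) auto

context hecke_at_root
begin

text \<open>
  What is used of a polynomial in the \<open>L\<^sub>k\<close> whose value at the weight \<open>i\<close> is non-zero: it can be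
  cancelled on the whole generalized weight space, and it acts on true joint eigenvectors by a non-zero
  scalar. These two effects replace its inverse as a power series in the \<open>y\<^sub>k\<close>.
\<close>

definition regular_on :: "(nat \<Rightarrow> int) \<Rightarrow> 'a \<Rightarrow> bool" where
  "regular_on i g \<longleftrightarrow> g \<in> bicommutant (range L) \<and>
     (\<forall>h\<in>weight_space i. h * g = 0 \<longrightarrow> h = 0) \<and>
     (\<exists>c. c \<noteq> 0 \<and> (\<forall>h. (\<forall>j\<in>{1..n}. h * L j = (q powi i j) *s h) \<longrightarrow> h * g = c *s h))"

lemma regular_on_one: "regular_on i 1"
  by (auto simp: regular_on_def intro!: exI[of _ 1])

lemma weight_space_mult_right:
  "h \<in> weight_space i \<Longrightarrow> a \<in> bicommutant (range L) \<Longrightarrow> h * a \<in> weight_space i"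
proof -
  assume h: "h \<in> weight_space i" and a: "a \<in> bicommutant (range L)"
  have "h * a * (L r - (q powi i r) *s 1) ^ N = h * (L r - (q powi i r) *s 1) ^ N * a" for r N
    using Lalg.commute[OF a, of "(L r - (q powi i r) *s 1) ^ N"] by (simp add: mult.assoc)
  then show ?thesis
    using h unfolding weight_space_def mem_Collect_eq by (metis mult_zero_left)
qed

lemma regular_on_mult:
  assumes g: "regular_on i g" and g': "regular_on i g'"
  shows "regular_on i (g * g')"
proof -
  obtain c where c: "c \<noteq> 0" "\<And>h. \<forall>j\<in>{1..n}. h * L j = (q powi i j) *s h \<Longrightarrow> h * g = c *s h"
    using g unfolding regular_on_def by blast
  obtain c' where c': "c' \<noteq> 0" "\<And>h. \<forall>j\<in>{1..n}. h * L j = (q powi i j) *s h \<Longrightarrow> h * g' = c' *s h"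
    using g' unfolding regular_on_def by blast
  have "h * (g * g') = (c * c') *s h" if "\<forall>j\<in>{1..n}. h * L j = (q powi i j) *s h" for h
    using c(2)[OF that] c'(2)[OF that] by (simp add: scale_mult_left flip: mult.assoc)
  moreover have "h = 0" if "h \<in> weight_space i" "h * (g * g') = 0" for h
    using that g g' weight_space_mult_right[OF that(1), of g] unfolding regular_on_def
    by (metis mult.assoc)
  ultimately show ?thesis
    using g g' c(1) c'(1) unfolding regular_on_def by (auto intro!: exI[of _ "c * c'"])
qed

lemma regular_on_prod_list: "(\<And>x. x \<in> set xs \<Longrightarrow> regular_on i (f x)) \<Longrightarrow> regular_on i (prod_list (map f xs))"
  by (induction xs) (auto intro: regular_on_one regular_on_mult)

lemma regular_on_linear:
  assumes "k \<in> {1..n}" "a \<noteq> q powi i k"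
  shows "regular_on i (L k - a *s 1)"
proof -
  have "h = 0" if h: "h \<in> weight_space i" "h * (L k - a *s 1) = 0" for h
  proof -
    obtain N where "h * (L k - (q powi i k) *s 1) ^ N = 0"
      using h(1) assms(1) unfolding weight_space_def by blast
    then show ?thesis
      using Lalg.generalized_eigenspaces_disjoint[of "L k" a "q powi i k" h 1 N] assms(2) h(2) by simp
  qed
  then show ?thesis
    using assms unfolding regular_on_def
    by (auto intro!: exI[of _ "q powi i k - a"] simp: right_diff_distrib scale_mult_right scale_left_diff_distrib)
qed

text \<open>
  Orthogonality leaves one summand of \<open>y\<^sub>k\<close>, and \<open>1 - q\<^sup>-\<^sup>c L\<^sub>k = - q\<^sup>-\<^sup>c (L\<^sub>k - q\<^sup>c)\<close>.
\<close>

lemma idem_mult_y: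
  assumes i: "i \<in> residue_seqs e n"
  shows "idem i * y k = (- (q powi (- i k))) *s ((L k - (q powi i k) *s 1) * idem i)"
proof -
  have fin: "finite (residue_seqs e n)" by (auto simp: residue_seqs_def intro!: finite_PiE)
  let ?g = "\<lambda>j. 1 - (q powi (- j k)) *s L k"
  have "idem i * y k = (\<Sum>j\<in>residue_seqs e n. ?g j * (idem i * idem j))"
    using idem_exists[OF i] by (simp add: y_def sum_distrib_left Lalg.left_commute)
  also have "\<dots> = (\<Sum>j\<in>residue_seqs e n. if j = i then ?g i * idem i else 0)"
    using idem_exists i weight_space_orthogonal[of _ i "idem i" "idem _"] by (intro sum.cong) auto
  also have "\<dots> = ?g i * idem i" using fin i by simp
  also have "?g i = (- (q powi (- i k))) *s (L k - (q powi i k) *s 1)"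
    using q_nonzero by (simp add: scale_right_diff_distrib power_int_minus)
  finally show ?thesis by (simp add: scale_mult_left)
qed

lemma idem_mult_y_prod:
  assumes i: "i \<in> residue_seqs e n"
  shows "\<exists>c. c \<noteq> 0 \<and> idem i * prod_list (map (\<lambda>k. y k ^ f k) ks) =
    c *s (prod_list (map (\<lambda>k. (L k - (q powi i k) *s 1) ^ f k) ks) * idem i)"
proof (induction ks)
  case Nil
  show ?case by (auto intro!: exI[of _ 1])
next
  case (Cons k ks)
  obtain c where c: "c \<noteq> 0" "idem i * prod_list (map (\<lambda>k. y k ^ f k) ks) =
      c *s (prod_list (map (\<lambda>k. (L k - (q powi i k) *s 1) ^ f k) ks) * idem i)"
    using Cons by blast
  define \<kappa> where "\<kappa> = - (q powi (- i k))"
  let ?X = "L k - (q powi i k) *s 1"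
  have pow: "idem i * y k ^ a = (\<kappa> ^ a) *s (?X ^ a * idem i)" for a
  proof (induction a)
    case (Suc a)
    have "idem i * y k ^ Suc a = idem i * y k * y k ^ a" by (simp add: mult.assoc)
    also have "\<dots> = \<kappa> *s (?X * (idem i * y k ^ a))"
      unfolding idem_mult_y[OF i] by (simp add: \<kappa>_def scale_mult_left mult.assoc)
    also have "\<dots> = \<kappa> ^ Suc a *s (?X ^ Suc a * idem i)"
      unfolding Suc by (simp add: scale_mult_right mult.assoc)
    finally show ?case .
  qed simp
  have "idem i * prod_list (map (\<lambda>k. y k ^ f k) (k # ks)) =
      (\<kappa> ^ f k) *s (?X ^ f k * (idem i * prod_list (map (\<lambda>k. y k ^ f k) ks)))"
    using pow[of "f k"] by (simp add: scale_mult_left flip: mult.assoc)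
  also have "\<dots> = (\<kappa> ^ f k * c) *s (prod_list (map (\<lambda>k. (L k - (q powi i k) *s 1) ^ f k) (k # ks)) * idem i)"
    unfolding c(2) by (simp add: scale_mult_right mult.assoc)
  finally show ?case
    using c(1) q_nonzero by (intro exI[of _ "\<kappa> ^ f k * c"]) (auto simp: \<kappa>_def)
qed

end

context hecke_sign
begin

text \<open>
  The exponents \<open>i\<close> of the linear factors \<open>L\<^sub>k - q\<^sup>i\<close> of \<open>z\<close>: those that come from \<open>u\<close>, and for \<open>k > 1\<close>
  the one that arises from the geometric series in the recursion.
\<close>

definition linear_factors :: "nat \<Rightarrow> int list" where
  "linear_factors k = concat (map (\<lambda>i. replicate (u_exponent i) i) [0..int e - 1]) @
     (if k = 1 then [] else [(s - \<epsilon>) mod int e])"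

definition factor :: "nat \<Rightarrow> 'a" where
  "factor k = prod_list (map (\<lambda>i. L k - (q powi i) *s 1) (linear_factors k))"

lemma factor_1: "factor 1 = u_factor (L 1)"
  by (simp only: factor_def linear_factors_def u_factor_def prod_list_concat_replicate if_True append_Nil2 simp_thms)

lemma factor_Suc: "1 \<le> m \<Longrightarrow> factor (Suc m) = u_factor (L (Suc m)) * (L (Suc m) - (q powi (s - \<epsilon>)) *s 1)"
  by (simp add: factor_def linear_factors_def u_factor_def prod_list_concat_replicate q_powi_mod)

lemma z_part_factored:
  "1 \<le> m \<Longrightarrow> m \<le> n \<Longrightarrow> \<exists>c. c \<noteq> 0 \<and> z_part m = c *s prod_list (map factor [1..<m + 1])"
proof (induction m rule: dec_induct)
  case base
  have "poincare t 1 = 1" by (simp add: poincare_def descending_def)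
  moreover have "u_part 1 = u_factor (L 1)" using u_part_Suc[of 0] by (simp add: u_part_0)
  ultimately show ?case
    using factor_1 by (auto simp: z_part_def intro!: exI[of _ 1])
next
  case (step m)
  then obtain c where c: "c \<noteq> 0" "z_part m = c *s prod_list (map factor [1..<m + 1])" by auto
  let ?\<delta> = "content (Suc m) - content m"
  have "q powi \<epsilon> \<noteq> 1"
    using sign q_neq_1 q_nonzero by (auto simp: power_int_minus)
  then have \<delta>: "?\<delta> \<noteq> 0"
    using content_nonzero[of m] by (simp add: content_Suc)
  have "?\<delta> *s z_part (Suc m) = (q powi (\<epsilon> * int m)) *s (z_part m * factor (Suc m))"
    using z_part_step[of m] step factor_Suc[of m] by (simp add: mult.assoc)
  also have "\<dots> = ?\<delta> *s ((q powi (\<epsilon> * int m) * c / ?\<delta>) *s prod_list (map factor [1..<Suc m + 1]))"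
    using \<delta> by (simp add: c(2) scale_mult_left)
  finally have "z_part (Suc m) = (q powi (\<epsilon> * int m) * c / ?\<delta>) *s prod_list (map factor [1..<Suc m + 1])"
    by (rule scale_left_imp_eq[OF \<delta>])
  moreover have "q powi (\<epsilon> * int m) * c / ?\<delta> \<noteq> 0"
    using c(1) \<delta> q_nonzero by simp
  ultimately show ?case by blast
qed

lemma res_seq_mem: "res_seq \<epsilon> s \<in> residue_seqs e n"
  using e_pos by (auto simp: res_seq_def residue_seqs_def)

lemma q_powi_res_seq: "k \<in> {1..n} \<Longrightarrow> q powi res_seq \<epsilon> s k = content k"
  by (simp add: res_seq_def content_def q_powi_mod)

text \<open>
  The extra factor is the vanishing one exactly when \<open>s - \<epsilon>\<close> and \<open>s + \<epsilon> (k - 1)\<close> agree modulo \<open>e\<close>,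
  that is, when \<open>e\<close> divides \<open>k\<close>. It is absent for \<open>k = 1\<close>, in agreement with \<open>e \<ge> 2\<close>.
\<close>

lemma count_linear_factors:
  assumes k: "k \<in> {1..n}"
  shows "count_list (linear_factors k) (res_seq \<epsilon> s k) = d \<epsilon> s k"
proof -
  have res: "res_seq \<epsilon> s k \<in> {0..<int e}"
    using k e_pos by (simp add: res_seq_def)
  then have 1: "count_list (concat (map (\<lambda>i. replicate (u_exponent i) i) [0..int e - 1])) (res_seq \<epsilon> s k) = u_exponent (res_seq \<epsilon> s k)"
    by (subst count_list_concat_replicate) auto
  have "(s - \<epsilon>) mod int e = res_seq \<epsilon> s k \<longleftrightarrow> int e dvd \<epsilon> * int k"
    using k by (simp add: res_seq_def mod_eq_dvd_iff algebra_simps dvd_diff_commute)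
  also have "\<dots> \<longleftrightarrow> e dvd k"
    using sign by auto
  finally have 2: "(s - \<epsilon>) mod int e = res_seq \<epsilon> s k \<longleftrightarrow> e dvd k" .
  have "count_list (if k = 1 then [] else [(s - \<epsilon>) mod int e]) (res_seq \<epsilon> s k) = of_bool (e dvd k)"
    using e_ge_2 2 by auto
  then show ?thesis
    by (simp only: linear_factors_def count_list_append 1) (simp add: d_def u_exponent_def)
qed

lemma factor_split:
  assumes k: "k \<in> {1..n}"
  obtains g where "regular_on (res_seq \<epsilon> s) g"
    "factor k = (L k - (q powi res_seq \<epsilon> s k) *s 1) ^ d \<epsilon> s k * g"
proof
  let ?f = "\<lambda>i. L k - (q powi i) *s 1"
  let ?g = "prod_list (map ?f (filter (\<lambda>i. i \<noteq> res_seq \<epsilon> s k) (linear_factors k)))"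
  show "factor k = ?f (res_seq \<epsilon> s k) ^ d \<epsilon> s k * ?g"
    unfolding factor_def
    by (subst Lalg.prod_list_partition[where R = "\<lambda>i. i = res_seq \<epsilon> s k"])
       (auto simp: prod_list_filter_eq count_linear_factors[OF k])
  have "res_seq \<epsilon> s k \<in> {0..<int e}"
    using k e_pos by (simp add: res_seq_def)
  moreover have "set (linear_factors k) \<subseteq> {0..<int e}"
    using e_pos by (auto simp: linear_factors_def)
  ultimately show "regular_on (res_seq \<epsilon> s) ?g"
    using inj_onD[OF inj_on_q_powi, of _ "res_seq \<epsilon> s k"]
    by (intro regular_on_prod_list regular_on_linear[OF k]) auto
qed

text \<open>
  In \<open>z = c W G e(i)\<close>, the factor \<open>W\<close> collects the linear factors that vanish at the weight and \<open>G\<close> the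
  others. All \<open>L\<^sub>j - q\<^sup>c\<close> that vanish at the weight kill \<open>z\<close>; cancelling \<open>G\<close>, they kill \<open>W e(i)\<close>. Thus
  \<open>W e(i)\<close> is a joint eigenvector, on which \<open>G\<close> is a non-zero scalar.
\<close>

lemma z_eq_idem_y_prod:
  assumes n: "1 \<le> n"
  shows "\<exists>C. C \<noteq> 0 \<and> z \<epsilon> s = C *s (idem (res_seq \<epsilon> s) * y_prod \<epsilon> s)"
proof -
  let ?i = "res_seq \<epsilon> s" and ?C = "bicommutant (range L)"
  define E where "E = idem ?i"
  have E: "E \<in> ?C" "E \<in> weight_space ?i" "\<And>h. h \<in> weight_space ?i \<Longrightarrow> h * E = h"
    using idem_exists[OF res_seq_mem] by (auto simp: E_def)
  define W where "W = prod_list (map (\<lambda>k. (L k - (q powi ?i k) *s 1) ^ d \<epsilon> s k) [1..<n + 1])"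
  have W: "W \<in> ?C" unfolding W_def by (intro Lalg.prod_list_mem) auto
  obtain c1 where c1: "c1 \<noteq> 0" "E * y_prod \<epsilon> s = c1 *s (W * E)"
    using idem_mult_y_prod[OF res_seq_mem, of "d \<epsilon> s" "[1..<n + 1]"]
    unfolding W_def E_def y_prod_def by blast
  have "\<forall>k\<in>{1..n}. \<exists>g. regular_on ?i g \<and> factor k = (L k - (q powi ?i k) *s 1) ^ d \<epsilon> s k * g"
    using factor_split by metis
  then obtain g where g: "\<And>k. k \<in> {1..n} \<Longrightarrow> regular_on ?i (g k)"
    "\<And>k. k \<in> {1..n} \<Longrightarrow> factor k = (L k - (q powi ?i k) *s 1) ^ d \<epsilon> s k * g k"
    by metis
  define G where "G = prod_list (map g [1..<n + 1])"
  have G: "regular_on ?i G"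
    unfolding G_def using g(1) by (intro regular_on_prod_list) auto
  then have GC: "G \<in> ?C" by (simp add: regular_on_def)
  have "map factor [1..<n + 1] = map (\<lambda>k. (L k - (q powi ?i k) *s 1) ^ d \<epsilon> s k * g k) [1..<n + 1]"
    using g(2) by auto
  moreover have "prod_list (map (\<lambda>k. (L k - (q powi ?i k) *s 1) ^ d \<epsilon> s k * g k) [1..<n + 1]) = W * G"
    unfolding W_def G_def using g(1)
    by (intro Lalg.prod_list_mult) (auto simp: regular_on_def)
  ultimately have "prod_list (map factor [1..<n + 1]) = W * G" by (simp only:)
  then obtain c2 where c2: "c2 \<noteq> 0" "z \<epsilon> s = c2 *s (W * G)"
    using z_part_factored[of n] n by (auto simp: z_part_n)
  have zL: "z \<epsilon> s * (L j - (q powi ?i j) *s 1) = 0" if "j \<in> {1..n}" for j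
    using z_part_L[of n j] that by (simp add: z_part_n q_powi_res_seq right_diff_distrib scale_mult_right)
  have "z \<epsilon> s \<in> weight_space ?i"
    unfolding weight_space_def using zL by (auto intro!: exI[of _ 1])
  then have "z \<epsilon> s = z \<epsilon> s * E" by (simp add: E(3))
  then have zE: "z \<epsilon> s = c2 *s (W * E * G)"
    using E(1) GC by (simp add: c2(2) scale_mult_left mult.assoc Lalg.commute[of G E])
  have wsp: "W * E \<in> weight_space ?i"
    using E(2) by (rule weight_space_mult_left)
  have "W * E * L j = (q powi ?i j) *s (W * E)" if j: "j \<in> {1..n}" for j
  proof -
    let ?X = "L j - (q powi ?i j) *s 1"
    have "c2 *s (W * E * ?X * G) = z \<epsilon> s * ?X"
      unfolding zE using GC by (simp add: scale_mult_left mult.assoc Lalg.commute[of ?X G])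
    then have "W * E * ?X * G = 0"
      using zL[OF j] c2(1) by simp
    moreover have "W * E * ?X \<in> weight_space ?i"
      by (intro weight_space_mult_right[OF wsp]) auto
    ultimately have "W * E * ?X = 0"
      using G unfolding regular_on_def by blast
    then show ?thesis by (simp add: right_diff_distrib scale_mult_right)
  qed
  then obtain c3 where c3: "c3 \<noteq> 0" "W * E * G = c3 *s (W * E)"
    using G unfolding regular_on_def by blast
  have "z \<epsilon> s = (c2 * c3 / c1) *s (E * y_prod \<epsilon> s)"
    unfolding zE c3(2) c1(2) using c1(1) by simp
  then show ?thesis
    unfolding E_def using c1(1) c2(1) c3(1) by (intro exI[of _ "c2 * c3 / c1"]) auto
qed

lemma hom_monomial_y_powers:
  assumes "set ks \<subseteq> {1..n}" "hom_monomial c x"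
  shows "hom_monomial (c + 2 * (\<Sum>k\<leftarrow>ks. int (f k))) (x * prod_list (map (\<lambda>k. y k ^ f k) ks))"
  using assms
proof (induction ks arbitrary: c x)
  case (Cons k ks)
  have "hom_monomial (c + 2 * int a) (x * y k ^ a)" for a
  proof (induction a)
    case (Suc a)
    then show ?case
      using hom_monomial.mult[OF Suc hom_monomial.y[of k]] Cons.prems(1)
      by (simp add: mult.assoc power_Suc2 algebra_simps del: power_Suc)
  qed (use Cons.prems in simp)
  then show ?case
    using Cons.IH[of "c + 2 * int (f k)" "x * y k ^ f k"] Cons.prems(1)
    by (simp add: mult.assoc algebra_simps)
qed simp

lemma idem_y_prod_homogeneous:
  "idem (res_seq \<epsilon> s) * y_prod \<epsilon> s \<in> graded_component (2 * (\<Sum>k=1..n. int (d \<epsilon> s k)))"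
proof -
  have "hom_monomial (0 + 2 * (\<Sum>k\<leftarrow>[1..<n + 1]. int (d \<epsilon> s k))) (idem (res_seq \<epsilon> s) * y_prod \<epsilon> s)"
    unfolding y_prod_def
    by (rule hom_monomial_y_powers) (auto intro: hom_monomial.idem res_seq_mem)
  moreover have "(\<Sum>k\<leftarrow>[1..<n + 1]. int (d \<epsilon> s k)) = (\<Sum>k=1..n. int (d \<epsilon> s k))"
    by (subst sum_set_upt_conv_sum_list_nat[symmetric]) (auto intro!: sum.cong)
  ultimately show ?thesis
    unfolding graded_component_def by (intro span_base) simp
qed

end

section \<open>The factorization and the degree\<close>

theorem theoremA7:
  fixes scale :: "'k::field \<Rightarrow> 'a::ring_1 \<Rightarrow> 'a"
    and proj :: "(hecke_gen, 'k) free_algebra \<Rightarrow> 'a"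
    and q :: 'k and e n :: nat and \<Lambda> :: "int \<Rightarrow> nat" and s \<epsilon> :: int
  assumes "cyclotomic_hecke scale proj q e \<Lambda> n"
    and "n \<ge> 1"
    and "q \<noteq> 0" and "q \<noteq> 1" and "quantum_char q = e"
    and "1 \<le> s" and "s \<le> int e"
    and "\<Lambda> (s mod int e) > 0"
    and "\<epsilon> \<in> {1, -1}"
  shows "(\<exists>C::'k. C \<noteq> 0 \<and>
            cyclotomic_hecke.z scale proj q e \<Lambda> n \<epsilon> s =
              scale C (cyclotomic_hecke.idem scale proj q e n (cyclotomic_hecke.res_seq e n \<epsilon> s)
                       * cyclotomic_hecke.y_prod scale proj q e \<Lambda> n \<epsilon> s))
       \<and> cyclotomic_hecke.z scale proj q e \<Lambda> n \<epsilon> s \<in>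
            cyclotomic_hecke.graded_component scale proj q e n
              (2 * (\<Sum>k=1..n. int (cyclotomic_hecke.d e \<Lambda> n \<epsilon> s k)))"
proof -
  interpret cyclotomic_hecke scale proj q e \<Lambda> n by fact
  interpret hecke_sign scale proj q e \<Lambda> n s \<epsilon> "if \<epsilon> = 1 then 1 else - inverse q"
    by unfold_locales (use assms in auto)
  obtain C where C: "C \<noteq> 0" "z \<epsilon> s = scale C (idem (res_seq \<epsilon> s) * y_prod \<epsilon> s)"
    using z_eq_idem_y_prod assms(2) by blast
  moreover have "z \<epsilon> s \<in> graded_component (2 * (\<Sum>k=1..n. int (d \<epsilon> s k)))"
    using idem_y_prod_homogeneous unfolding C(2) graded_component_def by (rule span_scale)
  ultimately show ?thesis by blast
qed

end
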